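(* Let $H$ be a graded connected Hopf algebra over $\Bbbk$, with finite-dimensional homogeneous components $H_m$, that is cofree as a graded coalgebra, and let $S$ be its antipode. For any nonnegative integer $m$, the characteristic polynomial of $S|_{H_m}$ is $$\chi\bigl(S|_{H_m}\bigr)(x)=(x+1)^{\mathrm{opal}(m)}(x-1)^{\mathrm{epal}(m)}(x^2-1)^{\mathrm{npal}(m)/2}.$$
   Context: $\Bbbk$ is a field of characteristic zero. A graded connected Hopf algebra is a bialgebra $H$ with product $\mu$, coproduct $\Delta$, unit $1$, counit $\varepsilon$ and a decomposition $H=\bigoplus_{m\ge 0}H_m$ such that $\mu(H_p\otimes H_q)\subseteq H_{p+q}$, $\Delta(H_m)\subseteq\bigoplus_{p+q=m}H_p\otimes H_q$, $1\in H_0$, $\varepsilon(H_m)=0$ for $m>0$, and $\dim H_0=1$. It automatically has an antipode $S$, which preserves each $H_m$. $H$ is cofree if, as a graded coalgebra, it is isomorphic to the deconcatenation coalgebra $\bigoplus_{k\ge0}V^{\otimes k}$ on a graded vector space $V$, with coproduct $\Delta(x_1\cdots x_k)=1\otimes(x_1\cdots x_k)+\sum_{i=1}^{k-1}(x_1\cdots x_i)\otimes(x_{i+1}\cdots x_k)+(x_1\cdots x_k)\otimes1$. Then $V\cong\mathcal P(H)=\{x\in H:\Delta(x)=1\otimes x+x\otimes1\}$ as graded vector spaces. Take $V=\mathcal P(H)$ and fix a homogeneous basis of $V$ as an alphabet; an element of degree $n$ is a letter of weight $n$, so there are $v_n=\dim V_n$ letters of weight $n$ ($n\ge1$). A word is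 a finite sequence of letters (the empty word included); its length is its number of letters and its weight is the sum of the weights of its letters. A palindrome is a word that coincides with its reversal. $\mathrm{epal}(m)$ and $\mathrm{opal}(m)$ denote the numbers of palindromes of weight $m$ of even and of odd length, respectively, and $\mathrm{npal}(m)$ denotes the number of non-palindromic words of weight $m$. *)

theory Defs
  imports
    "HOL-Library.Poly_Mapping"
    "Jordan_Normal_Form.Char_Poly"
begin

section \<open>Free vector spaces\<close>

text \<open>\<open>'b \<Rightarrow>\<^sub>0 'k\<close> is the vector space of finite formal linear combinations of elements of \<open>'b\<close>.
  Its type class product is a convolution along addition of keys and is never used here.\<close>

definition free_scale :: "'k::field \<Rightarrow> ('b \<Rightarrow>\<^sub>0 'k) \<Rightarrow> ('b \<Rightarrow>\<^sub>0 'k)"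
  where "free_scale c = Poly_Mapping.map ((*) c)"

lemma lookup_free_scale: "Poly_Mapping.lookup (free_scale c t) b = c * Poly_Mapping.lookup t b"
  by (simp add: free_scale_def Poly_Mapping.map.rep_eq when_def)

lemma vector_space_free_scale: "vector_space (free_scale :: 'k::field \<Rightarrow> ('b \<Rightarrow>\<^sub>0 'k) \<Rightarrow> _)"
  by unfold_locales
    (auto intro!: poly_mapping_eqI simp: lookup_free_scale lookup_add algebra_simps)

abbreviation pure :: "'b \<Rightarrow> ('b \<Rightarrow>\<^sub>0 'k::field)"
  where "pure b \<equiv> Poly_Mapping.single b 1"

text \<open>The linear extension of a map defined on \<open>'b\<close>, with values in a space with scalar
  multiplication \<open>scale\<close>.\<close>

definition lin_ext :: "('k::field \<Rightarrow> 'v::ab_group_add \<Rightarrow> 'v) \<Rightarrow> ('b \<Rightarrow> 'v) \<Rightarrow> ('b \<Rightarrow>\<^sub>0 'k) \<Rightarrow> 'v"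
  where "lin_ext scale f t = (\<Sum>b\<in>Poly_Mapping.keys t. scale (Poly_Mapping.lookup t b) (f b))"


section \<open>Tensor products\<close>

text \<open>For a vector space \<open>V\<close>, the space \<open>\<Oplus>\<^sub>k V\<^bsup>\<otimes>k\<^esup>\<close> is the quotient of the free vector space on
  \<open>'v list\<close> by the multilinearity relations below; a list \<open>[x\<^sub>1, \<dots>, x\<^sub>k]\<close> stands for the pure
  tensor \<open>x\<^sub>1 \<otimes> \<dots> \<otimes> x\<^sub>k\<close>. The relations are homogeneous in the length of the lists, so that lists
  of length \<open>k\<close> present \<open>V\<^bsup>\<otimes>k\<^esup>\<close>. Since the scalar multiplication is a term, the quotient cannot be
  a type; we work with representatives and with equality modulo the relations.\<close>

definition multilinear_rels ::
  "('k::field \<Rightarrow> 'v::ab_group_add \<Rightarrow> 'v) \<Rightarrow> ('v list \<Rightarrow>\<^sub>0 'k) set"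
  where "multilinear_rels scale = module.span free_scale
    {Poly_Mapping.single (us @ [scale a x + scale b y] @ vs) 1
       - Poly_Mapping.single (us @ [x] @ vs) a
       - Poly_Mapping.single (us @ [y] @ vs) b | us vs x y a b. True}"

definition tensor_eq ::
  "('k::field \<Rightarrow> 'v::ab_group_add \<Rightarrow> 'v) \<Rightarrow> ('v list \<Rightarrow>\<^sub>0 'k) \<Rightarrow> ('v list \<Rightarrow>\<^sub>0 'k) \<Rightarrow> bool"
  where "tensor_eq scale t u \<longleftrightarrow> t - u \<in> multilinear_rels scale"

text \<open>Elements of \<open>V \<otimes> V\<close> are written as formal combinations of pairs.\<close>

definition tensor2_eq ::
  "('k::field \<Rightarrow> 'v::ab_group_add \<Rightarrow> 'v) \<Rightarrow> ('v \<times> 'v \<Rightarrow>\<^sub>0 'k) \<Rightarrow> ('v \<times> 'v \<Rightarrow>\<^sub>0 'k) \<Rightarrow> bool"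
  where "tensor2_eq scale t u \<longleftrightarrow>
    tensor_eq scale (lin_ext free_scale (\<lambda>(a, b). pure [a, b]) t)
                    (lin_ext free_scale (\<lambda>(a, b). pure [a, b]) u)"


section \<open>Bialgebras and Hopf algebras\<close>

text \<open>\<open>comult x\<close> is a representative of \<open>\<Delta>(x) \<in> A \<otimes> A\<close>; every axiom depends only on its class
  in \<open>A \<otimes> A\<close>. In Sweedler notation, \<open>lin_ext s (\<lambda>(a, b). f a b) (comult x)\<close> is
  \<open>\<Sum> f(x\<^sub>(\<^sub>1\<^sub>), x\<^sub>(\<^sub>2\<^sub>))\<close>.\<close>

locale bialgebra = vector_space scale
  for scale :: "'k::field \<Rightarrow> 'a::ring_1 \<Rightarrow> 'a" +
  fixes comult :: "'a \<Rightarrow> ('a \<times> 'a \<Rightarrow>\<^sub>0 'k)"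
    and counit :: "'a \<Rightarrow> 'k"
  assumes scale_mult_left: "scale c x * y = scale c (x * y)"
    and scale_mult_right: "x * scale c y = scale c (x * y)"
    and comult_add: "tensor2_eq scale (comult (x + y)) (comult x + comult y)"
    and comult_scale: "tensor2_eq scale (comult (scale c x)) (free_scale c (comult x))"
    and counit_linear: "Vector_Spaces.linear scale (*) counit"
    and coassoc: "tensor_eq scale
        (lin_ext free_scale (\<lambda>(a, b). lin_ext free_scale (\<lambda>(c, d). pure [c, d, b]) (comult a))
          (comult x))
        (lin_ext free_scale (\<lambda>(a, b). lin_ext free_scale (\<lambda>(c, d). pure [a, c, d]) (comult b))
          (comult x))"
    and counit_left: "lin_ext scale (\<lambda>(a, b). scale (counit a) b) (comult x) = x"
    and counit_right: "lin_ext scale (\<lambda>(a, b). scale (counit b) a) (comult x) = x"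
    and comult_one: "tensor2_eq scale (comult 1) (pure (1, 1))"
    and comult_mult: "tensor2_eq scale (comult (x * y))
        (lin_ext free_scale (\<lambda>(a, b). lin_ext free_scale (\<lambda>(c, d). pure (a * c, b * d)) (comult y))
          (comult x))"
    and counit_one: "counit 1 = 1"
    and counit_mult: "counit (x * y) = counit x * counit y"
begin

definition is_antipode :: "('a \<Rightarrow> 'a) \<Rightarrow> bool"
  where "is_antipode S \<longleftrightarrow> Vector_Spaces.linear scale scale S \<and>
    (\<forall>x. lin_ext scale (\<lambda>(a, b). S a * b) (comult x) = scale (counit x) 1) \<and>
    (\<forall>x. lin_ext scale (\<lambda>(a, b). a * S b) (comult x) = scale (counit x) 1)"

definition primitives :: "'a set"
  where "primitives = {x. tensor2_eq scale (comult x) (pure (1, x) + pure (x, 1))}"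

end

text \<open>\<open>grading scale G\<close>: the space is the internal direct sum of the subspaces \<open>G n\<close>.\<close>

definition grading :: "('k::field \<Rightarrow> 'v::ab_group_add \<Rightarrow> 'v) \<Rightarrow> (nat \<Rightarrow> 'v set) \<Rightarrow> bool"
  where "grading scale G \<longleftrightarrow> (\<forall>n. module.subspace scale (G n)) \<and>
    (\<forall>x. \<exists>!g. (\<forall>n. g n \<in> G n) \<and> finite {n. g n \<noteq> 0} \<and> x = (\<Sum>n | g n \<noteq> 0. g n))"

text \<open>The existence of the antipode is automatic and hence not an axiom.\<close>

locale graded_connected_hopf_algebra = bialgebra scale comult counit
  for scale :: "'k::field \<Rightarrow> 'a::ring_1 \<Rightarrow> 'a"
    and comult :: "'a \<Rightarrow> ('a \<times> 'a \<Rightarrow>\<^sub>0 'k)"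
    and counit :: "'a \<Rightarrow> 'k" +
  fixes H :: "nat \<Rightarrow> 'a set"
  assumes grading: "grading scale H"
    and mult_graded: "x \<in> H p \<Longrightarrow> y \<in> H q \<Longrightarrow> x * y \<in> H (p + q)"
    and comult_graded: "x \<in> H m \<Longrightarrow>
      \<exists>t. tensor2_eq scale (comult x) t \<and>
          Poly_Mapping.keys t \<subseteq> (\<Union>p\<le>m. H p \<times> H (m - p))"
    and one_graded: "1 \<in> H 0"
    and counit_graded: "m > 0 \<Longrightarrow> x \<in> H m \<Longrightarrow> counit x = 0"
    and connected: "dim (H 0) = 1"
begin

definition locally_finite :: bool
  where "locally_finite \<longleftrightarrow> (\<forall>m. \<exists>B. finite B \<and> span B = H m)"

end


section \<open>Cofreeness\<close>

text \<open>The deconcatenation coproduct, on representatives of \<open>\<Oplus>\<^sub>k V\<^bsup>\<otimes>k\<^esup>\<close>; its counit is the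
  coefficient of the empty list.\<close>

definition deconcatenation :: "('v list \<Rightarrow>\<^sub>0 'k::field) \<Rightarrow> ('v list \<times> 'v list \<Rightarrow>\<^sub>0 'k)"
  where "deconcatenation =
    lin_ext free_scale (\<lambda>xs. \<Sum>i\<le>length xs. pure (take i xs, drop i xs))"

context graded_connected_hopf_algebra
begin

text \<open>\<open>\<phi>\<close> induces an isomorphism of graded coalgebras from \<open>\<Oplus>\<^sub>k V\<^bsup>\<otimes>k\<^esup>\<close> onto the Hopf algebra:
  the second condition says that \<open>\<phi>\<close> is well defined and injective on the quotient, and the last
  but one that \<open>\<Delta> \<circ> \<phi> = (\<phi> \<otimes> \<phi>) \<circ> \<Delta>\<close>.\<close>

definition deconcatenation_iso ::
  "('k \<Rightarrow> 'v::ab_group_add \<Rightarrow> 'v) \<Rightarrow> (nat \<Rightarrow> 'v set) \<Rightarrow> (('v list \<Rightarrow>\<^sub>0 'k) \<Rightarrow> 'a) \<Rightarrow> bool"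
  where "deconcatenation_iso scaleV V \<phi> \<longleftrightarrow>
    Vector_Spaces.linear free_scale scale \<phi> \<and>
    (\<forall>t u. \<phi> t = \<phi> u \<longleftrightarrow> tensor_eq scaleV t u) \<and>
    surj \<phi> \<and>
    (\<forall>xs ns. list_all2 (\<lambda>x n. x \<in> V n) xs ns \<longrightarrow> \<phi> (pure xs) \<in> H (sum_list ns)) \<and>
    (\<forall>t. tensor2_eq scale (comult (\<phi> t))
       (lin_ext free_scale (\<lambda>(us, vs). pure (\<phi> (pure us), \<phi> (pure vs))) (deconcatenation t))) \<and>
    (\<forall>t. counit (\<phi> t) = Poly_Mapping.lookup t [])"

definition cofree_over :: "('k \<Rightarrow> 'v::ab_group_add \<Rightarrow> 'v) \<Rightarrow> (nat \<Rightarrow> 'v set) \<Rightarrow> bool"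
  where "cofree_over scaleV V \<longleftrightarrow>
    vector_space scaleV \<and> grading scaleV V \<and> (\<exists>\<phi>. deconcatenation_iso scaleV V \<phi>)"

definition homogeneous_basis_of_primitives :: "'a set \<Rightarrow> bool"
  where "homogeneous_basis_of_primitives B \<longleftrightarrow>
    B \<subseteq> (\<Union>n. H n) \<and> independent B \<and> span B = primitives"

end


section \<open>Words and palindromes\<close>

text \<open>The degree is unique for nonzero homogeneous elements, in particular for letters.\<close>

definition letter_weight :: "(nat \<Rightarrow> 'a set) \<Rightarrow> 'a \<Rightarrow> nat"
  where "letter_weight H b = (THE n. b \<in> H n)"

definition words :: "(nat \<Rightarrow> 'a set) \<Rightarrow> 'a set \<Rightarrow> nat \<Rightarrow> 'a list set"
  where "words H B m = {w. set w \<subseteq> B \<and> sum_list (map (letter_weight H) w) = m}"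

definition epal :: "(nat \<Rightarrow> 'a set) \<Rightarrow> 'a set \<Rightarrow> nat \<Rightarrow> nat"
  where "epal H B m = card {w \<in> words H B m. rev w = w \<and> even (length w)}"

definition opal :: "(nat \<Rightarrow> 'a set) \<Rightarrow> 'a set \<Rightarrow> nat \<Rightarrow> nat"
  where "opal H B m = card {w \<in> words H B m. rev w = w \<and> odd (length w)}"

definition npal :: "(nat \<Rightarrow> 'a set) \<Rightarrow> 'a set \<Rightarrow> nat \<Rightarrow> nat"
  where "npal H B m = card {w \<in> words H B m. rev w \<noteq> w}"

lemma even_npal: "even (npal H B m)"
proof -
  define A where "A = {w \<in> words H B m. rev w \<noteq> w}"
  have A_rev: "rev w \<in> A \<and> rev w \<noteq> w" if "w \<in> A" for w
    using that by (auto simp: A_def words_def rev_map[symmetric])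
  show ?thesis
  proof (cases "finite A")
    case True
    define C where "C = (\<lambda>w. {w, rev w}) ` A"
    have U: "\<Union>C = A"
      using A_rev by (auto simp: C_def)
    have "2 * card C = card (\<Union>C)"
    proof (rule card_partition)
      show "finite C" using True by (simp add: C_def)
      show "finite (\<Union>C)" using U True by simp
      show "card c = 2" if "c \<in> C" for c
        using that A_rev by (fastforce simp: C_def card_2_iff)
      show "c \<inter> d = {}" if "c \<in> C" "d \<in> C" "c \<noteq> d" for c d
        using that by (auto simp: C_def)
    qed
    then have "card A = 2 * card C"
      using U by simp
    then show ?thesis
      by (simp add: npal_def A_def)
  qed (simp add: npal_def A_def)
qed


section \<open>Characteristic polynomial of an endomorphism\<close>

definition ordered_basis ::
  "('k::field \<Rightarrow> 'v::ab_group_add \<Rightarrow> 'v) \<Rightarrow> 'v set \<Rightarrow> 'v list \<Rightarrow> bool"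
  where "ordered_basis scale U bs \<longleftrightarrow>
    distinct bs \<and> \<not> module.dependent scale (set bs) \<and> module.span scale (set bs) = U"

definition endo_matrix ::
  "('k::field \<Rightarrow> 'v::ab_group_add \<Rightarrow> 'v) \<Rightarrow> 'v list \<Rightarrow> ('v \<Rightarrow> 'v) \<Rightarrow> 'k mat"
  where "endo_matrix scale bs f = mat (length bs) (length bs)
    (\<lambda>(i, j). module.representation scale (set bs) (f (bs ! j)) (bs ! i))"

text \<open>Meaningful for a finite-dimensional subspace \<open>U\<close> invariant under the linear map \<open>f\<close>; the
  value does not depend on the chosen basis.\<close>

definition char_poly_on ::
  "('k::field \<Rightarrow> 'v::ab_group_add \<Rightarrow> 'v) \<Rightarrow> 'v set \<Rightarrow> ('v \<Rightarrow> 'v) \<Rightarrow> 'k poly"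
  where "char_poly_on scale U f =
    char_poly (endo_matrix scale (SOME bs. ordered_basis scale U bs) f)"

end

theory Submission
  imports Defs
begin

text \<open>Choose an isomorphism of graded coalgebras from the deconcatenation coalgebra of a space \<open>V\<close> onto
\<open>H\<close>. It maps the words over a basis of \<open>V\<close> to a basis of \<open>H\<close>, and \<open>V\<close> itself onto the primitive
elements, so the basis of \<open>V\<close> may be taken to correspond to \<open>B\<close>. Then the words of weight \<open>m\<close> give a
basis of \<open>H m\<close> (\<open>independent_word_of\<close>, \<open>span_word_of\<close>).

The product of \<open>H\<close> is not determined by its coalgebra structure, but its top part is: because the
coproduct is multiplicative, the product of two words is, modulo shorter words, the sum of their
shuffles (\<open>coord_Cons_word_mult\<close>). The antipode of the shuffle algebra is reversal with the sign
\<open>(-1)\<close> to the length. Consequently the antipode of \<open>H\<close> sends a word \<open>w\<close> to the signed reversal of \<open>w\<close>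
plus a combination of shorter words (\<open>coord_antipode_word\<close>). This is proved by induction on the length
from the recursion for the antipode of a word in terms of the antipodes of its proper prefixes.

Hence the antipode is block triangular on \<open>H m\<close> with respect to the length of words, and its diagonal
blocks are signed reversals. An even palindrome contributes the eigenvalue \<open>1\<close>, an odd one \<open>-1\<close>, and a
pair \<open>{w, rev w}\<close> of non-palindromic words contributes both (\<open>char_poly_on_signed_reversal\<close>).

Throughout, elements of \<open>H\<close> are handled by their coordinates with respect to the basis of words. In
these terms the coproduct is dual to concatenation (\<open>coord_append\<close>), and computations with classes
of formal tensors become computations with finite sums of scalars.\<close>

section \<open>Linear extensions and tensors\<close>

lemma vector_space_field: "vector_space ((*) :: 'k::field \<Rightarrow> 'k \<Rightarrow> 'k)"
  by unfold_locales (auto simp: algebra_simps)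

interpretation free: vector_space "free_scale :: 'k::field \<Rightarrow> ('b \<Rightarrow>\<^sub>0 'k) \<Rightarrow> _"
  by (rule vector_space_free_scale)

lemma free_scale_single: "free_scale c (Poly_Mapping.single b d) = Poly_Mapping.single b (c * d)"
  by (auto intro!: poly_mapping_eqI simp: lookup_free_scale lookup_single when_def)

lemma lin_ext_superset:
  assumes "vector_space scale" "finite A" "Poly_Mapping.keys t \<subseteq> A"
  shows "lin_ext scale f t = (\<Sum>b\<in>A. scale (Poly_Mapping.lookup t b) (f b))"
proof -
  interpret vector_space scale by fact
  show ?thesis
    unfolding lin_ext_def
    by (rule sum.mono_neutral_left) (use assms in \<open>auto simp: in_keys_iff\<close>)
qed

lemma lin_ext_pure [simp]:
  assumes "vector_space scale"
  shows "lin_ext scale f (pure b) = f b"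
proof -
  interpret vector_space scale by fact
  show ?thesis by (simp add: lin_ext_def)
qed

lemma linear_lin_ext:
  assumes "vector_space scale"
  shows "Vector_Spaces.linear free_scale scale (lin_ext scale f)"
proof -
  interpret vector_space scale by fact
  show ?thesis
    unfolding Vector_Spaces.linear_iff
  proof (intro conjI allI)
    fix t u :: "'c \<Rightarrow>\<^sub>0 'a" and c :: 'a
    let ?A = "Poly_Mapping.keys t \<union> Poly_Mapping.keys u"
    have A: "finite ?A" "Poly_Mapping.keys (t + u) \<subseteq> ?A"
      using keys_add[of t u] by auto
    then show "lin_ext scale f (t + u) = lin_ext scale f t + lin_ext scale f u"
      by (simp add: lin_ext_superset[OF assms, of ?A] lookup_add scale_left_distrib sum.distrib)
    have "Poly_Mapping.keys (free_scale c t) \<subseteq> Poly_Mapping.keys t"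
      by (auto simp: in_keys_iff lookup_free_scale)
    then show "lin_ext scale f (free_scale c t) = scale c (lin_ext scale f t)"
      by (simp add: lin_ext_superset[OF assms, of "Poly_Mapping.keys t"] lookup_free_scale
          scale_sum_right)
  qed (use assms vector_space_free_scale in auto)
qed

lemmas linear_addD = Vector_Spaces.linear_iff[THEN iffD1, THEN conjunct2, THEN conjunct2,
    THEN conjunct1, rule_format]
lemmas linear_scaleD = Vector_Spaces.linear_iff[THEN iffD1, THEN conjunct2, THEN conjunct2,
    THEN conjunct2, rule_format]

lemma linear_sumD:
  assumes "Vector_Spaces.linear s1 s2 f"
  shows "f (sum g A) = (\<Sum>a\<in>A. f (g a))"
proof -
  interpret Vector_Spaces.linear s1 s2 f by fact
  show ?thesis by (rule sum)
qed

lemma linear_diffD: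
  assumes "Vector_Spaces.linear s1 s2 f"
  shows "f (x - y) = f x - f y"
proof -
  interpret Vector_Spaces.linear s1 s2 f by fact
  show ?thesis by (rule diff)
qed

lemma linear_zeroD:
  assumes "Vector_Spaces.linear s1 s2 f"
  shows "f 0 = 0"
proof -
  interpret Vector_Spaces.linear s1 s2 f by fact
  show ?thesis by (rule zero)
qed

lemma free_expansion:
  "t = (\<Sum>b\<in>Poly_Mapping.keys t. free_scale (Poly_Mapping.lookup t b) (pure b))"
  by (rule poly_mapping_eqI)
    (simp add: lookup_sum lookup_free_scale lookup_single when_def if_distrib in_keys_iff cong: if_cong)

lemma linear_eq_lin_ext:
  assumes "Vector_Spaces.linear free_scale scale F"
  shows "F t = lin_ext scale (\<lambda>b. F (pure b)) t"
  by (subst free_expansion[of t])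
    (simp add: linear_sumD[OF assms] linear_scaleD[OF assms] lin_ext_def)

lemma linear_lin_ext_comp:
  assumes "Vector_Spaces.linear s1 s2 F"
  shows "F (lin_ext s1 f t) = lin_ext s2 (\<lambda>b. F (f b)) t"
  by (simp add: lin_ext_def linear_sumD[OF assms] linear_scaleD[OF assms])

text \<open>The universal property of the tensor powers: a function on lists that is linear in every slot kills
the multilinearity relations, so its linear extension depends only on the class of a tensor. This is
why the coordinate functions below are well defined.\<close>

lemma tensor_eq_lin_ext:
  assumes s: "vector_space scale" and s': "vector_space scale'"
    and f: "\<And>us vs x y a b. f (us @ [scale a x + scale b y] @ vs) =
      scale' a (f (us @ [x] @ vs)) + scale' b (f (us @ [y] @ vs))"
    and eq: "tensor_eq scale t u"
  shows "lin_ext scale' f t = lin_ext scale' f u"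
proof -
  interpret s': vector_space scale' by fact
  interpret L: Vector_Spaces.linear free_scale scale' "lin_ext scale' f"
    by (rule linear_lin_ext[OF s'])
  have single: "lin_ext scale' f (Poly_Mapping.single b c) = scale' c (f b)" for b c
    by (simp add: lin_ext_def)
  have "t - u \<in> {t. lin_ext scale' f t = 0}"
    using eq unfolding tensor_eq_def multilinear_rels_def
  proof (rule rev_subsetD, intro free.span_minimal)
    show "free.subspace {t. lin_ext scale' f t = 0}"
      by (rule L.subspace_kernel)
    show "{Poly_Mapping.single (us @ [scale a x + scale b y] @ vs) 1
       - Poly_Mapping.single (us @ [x] @ vs) a
       - Poly_Mapping.single (us @ [y] @ vs) b | us vs x y a b. True} \<subseteq> {t. lin_ext scale' f t = 0}"
      using f by (auto simp: L.diff single)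
  qed
  then show ?thesis by (simp add: L.diff)
qed

definition bilinear_map ::
  "('k::field \<Rightarrow> 'a::ab_group_add \<Rightarrow> 'a) \<Rightarrow> ('k \<Rightarrow> 'w::ab_group_add \<Rightarrow> 'w) \<Rightarrow> ('a \<Rightarrow> 'a \<Rightarrow> 'w) \<Rightarrow> bool"
  where "bilinear_map scale scale' \<beta> \<longleftrightarrow>
    (\<forall>y. Vector_Spaces.linear scale scale' (\<lambda>x. \<beta> x y)) \<and>
    (\<forall>x. Vector_Spaces.linear scale scale' (\<beta> x))"

text \<open>This is what makes Sweedler notation legitimate: a bilinear map may be applied to any
representative of a coproduct.\<close>

lemma tensor2_eq_lin_ext:
  assumes \<beta>: "bilinear_map scale scale' \<beta>" and eq: "tensor2_eq scale t u"
  shows "lin_ext scale' (\<lambda>(a, b). \<beta> a b) t = lin_ext scale' (\<lambda>(a, b). \<beta> a b) u"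
proof -
  have l: "Vector_Spaces.linear scale scale' (\<lambda>x. \<beta> x y)"
    and r: "Vector_Spaces.linear scale scale' (\<beta> x)" for x y
    using \<beta> by (auto simp: bilinear_map_def)
  then have s: "vector_space scale" "vector_space scale'"
    by (auto simp: Vector_Spaces.linear_iff)
  interpret s': vector_space scale' by (rule s)
  define f where "f = (\<lambda>xs. if length xs = 2 then \<beta> (xs ! 0) (xs ! 1) else 0)"
  have *: "lin_ext scale' (\<lambda>(a, b). \<beta> a b) t =
    lin_ext scale' f (lin_ext free_scale (\<lambda>(a, b). pure [a, b]) t)" for t
    by (subst linear_lin_ext_comp[OF linear_lin_ext[OF s(2)]])
      (simp add: f_def s split_def)
  have "f (us @ [scale a x + scale b y] @ vs) =
      scale' a (f (us @ [x] @ vs)) + scale' b (f (us @ [y] @ vs))" for us vs x y a b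
    by (cases us; cases vs; cases "tl us"; cases "tl vs")
      (auto simp: f_def linear_addD[OF l] linear_addD[OF r] linear_scaleD[OF l] linear_scaleD[OF r])
  from tensor_eq_lin_ext[OF s this eq[unfolded tensor2_eq_def]]
  show ?thesis by (simp add: *)
qed

section \<open>Words in a cofree Hopf algebra\<close>

text \<open>The sum is itself a one-term homogeneous decomposition, of degree \<open>m\<close>; comparing the two
decompositions gives both claims.\<close>

lemma grading_decomposition_unique:
  assumes "grading scale G" "vector_space scale" "finite A"
    and "\<And>n. n \<in> A \<Longrightarrow> f n \<in> G n" and "(\<Sum>n\<in>A. f n) \<in> G m"
  shows "(\<Sum>n\<in>A. f n) = (if m \<in> A then f m else 0)" and "\<And>n. n \<in> A \<Longrightarrow> n \<noteq> m \<Longrightarrow> f n = 0"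
proof -
  interpret vector_space scale by fact
  have sub: "subspace (G n)" for n
    using assms(1) by (simp add: grading_def)
  define x where "x = (\<Sum>n\<in>A. f n)"
  define g where "g = (\<lambda>n. if n \<in> A then f n else 0)"
  define h where "h = (\<lambda>n. if n = m then x else 0)"
  have "\<exists>!g. (\<forall>n. g n \<in> G n) \<and> finite {n. g n \<noteq> 0} \<and> x = (\<Sum>n | g n \<noteq> 0. g n)"
    using assms(1) by (simp add: grading_def)
  moreover have "(\<forall>n. g n \<in> G n) \<and> finite {n. g n \<noteq> 0} \<and> x = (\<Sum>n | g n \<noteq> 0. g n)"
  proof (intro conjI allI)
    show "g n \<in> G n" for n
      using assms(4) sub[of n] by (auto simp: g_def subspace_0)
    show "finite {n. g n \<noteq> 0}"
      using assms(3) by (rule finite_subset[rotated]) (auto simp: g_def)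
    show "x = (\<Sum>n | g n \<noteq> 0. g n)"
      unfolding x_def by (rule sum.mono_neutral_cong_right) (use assms(3) in \<open>auto simp: g_def\<close>)
  qed
  moreover have "(\<forall>n. h n \<in> G n) \<and> finite {n. h n \<noteq> 0} \<and> x = (\<Sum>n | h n \<noteq> 0. h n)"
  proof (intro conjI allI)
    show "h n \<in> G n" for n
      using assms(5) sub[of n] by (auto simp: h_def x_def subspace_0)
    show "finite {n. h n \<noteq> 0}"
      by (rule finite_subset[of _ "{m}"]) (auto simp: h_def)
    show "x = (\<Sum>n | h n \<noteq> 0. h n)"
      by (cases "x = 0") (auto simp: h_def)
  qed
  ultimately have gh: "g = h" by blast
  from fun_cong[OF gh, of m] show "(\<Sum>n\<in>A. f n) = (if m \<in> A then f m else 0)"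
    by (simp add: g_def h_def x_def)
  show "f n = 0" if "n \<in> A" "n \<noteq> m" for n
    using fun_cong[OF gh, of n] that by (simp add: g_def h_def)
qed

text \<open>An isomorphism with the deconcatenation coalgebra is fixed; the abstract space \<open>V\<close> is identified
with the primitive elements only later.\<close>

locale cofree_hopf_algebra = graded_connected_hopf_algebra scale comult counit H
  for scale :: "'k::field \<Rightarrow> 'a::ring_1 \<Rightarrow> 'a"
    and comult :: "'a \<Rightarrow> ('a \<times> 'a \<Rightarrow>\<^sub>0 'k)"
    and counit :: "'a \<Rightarrow> 'k"
    and H :: "nat \<Rightarrow> 'a set" +
  fixes scaleV :: "'k \<Rightarrow> 'v::ab_group_add \<Rightarrow> 'v"
    and V :: "nat \<Rightarrow> 'v set"
    and \<phi> :: "('v list \<Rightarrow>\<^sub>0 'k) \<Rightarrow> 'a"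
  assumes vector_space_V: "vector_space scaleV"
    and grading_V: "grading scaleV V"
    and iso: "deconcatenation_iso scaleV V \<phi>"
begin

sublocale VV: vector_space scaleV
  by (rule vector_space_V)

lemma vector_space_H: "vector_space scale" ..

lemma linear_phi: "Vector_Spaces.linear free_scale scale \<phi>"
  using iso by (simp add: deconcatenation_iso_def)

lemma phi_eq_iff: "\<phi> t = \<phi> u \<longleftrightarrow> tensor_eq scaleV t u"
  using iso by (simp add: deconcatenation_iso_def)

definition word :: "'v list \<Rightarrow> 'a"
  where "word xs = \<phi> (pure xs)"

lemma phi_eq_lin_ext: "\<phi> t = lin_ext scale word t"
  unfolding word_def by (rule linear_eq_lin_ext[OF linear_phi])

lemma counit_word: "counit (word xs) = (if xs = [] then 1 else 0)"
  using iso by (simp add: deconcatenation_iso_def word_def lookup_single)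

lemma word_graded: "list_all2 (\<lambda>x n. x \<in> V n) xs ns \<Longrightarrow> word xs \<in> H (sum_list ns)"
  using iso by (simp add: deconcatenation_iso_def word_def)

lemma word_multilinear:
  "word (us @ [scaleV a x + scaleV b y] @ vs) =
    scale a (word (us @ [x] @ vs)) + scale b (word (us @ [y] @ vs))"
proof -
  let ?S = "Poly_Mapping.single :: 'v list \<Rightarrow> 'k \<Rightarrow> 'v list \<Rightarrow>\<^sub>0 'k"
  have "tensor_eq scaleV (?S (us @ [scaleV a x + scaleV b y] @ vs) 1)
      (?S (us @ [x] @ vs) a + ?S (us @ [y] @ vs) b)"
    unfolding tensor_eq_def multilinear_rels_def
    by (rule free.span_base, rule CollectI, (rule exI)+, rule conjI[OF _ TrueI],
        rule diff_diff_eq[symmetric])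
  then have "word (us @ [scaleV a x + scaleV b y] @ vs) =
      \<phi> (?S (us @ [x] @ vs) a + ?S (us @ [y] @ vs) b)"
    unfolding word_def by (simp add: phi_eq_iff)
  also have "\<dots> = \<phi> (free_scale a (pure (us @ [x] @ vs)) + free_scale b (pure (us @ [y] @ vs)))"
    by (simp add: free_scale_single)
  finally show ?thesis
    by (simp only: linear_addD[OF linear_phi] linear_scaleD[OF linear_phi] word_def)
qed

lemma linear_word_slot: "Vector_Spaces.linear scaleV scale (\<lambda>x. word (us @ [x] @ vs))"
  unfolding Vector_Spaces.linear_iff
proof (intro conjI allI vector_space_V vector_space_H)
  show "word (us @ [x + y] @ vs) = word (us @ [x] @ vs) + word (us @ [y] @ vs)" for x y
    using word_multilinear[of us 1 x 1 y vs] by (simp add: VV.scale_one)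
  show "word (us @ [scaleV c x] @ vs) = scale c (word (us @ [x] @ vs))" for c x
    using word_multilinear[of us c x 0 x vs] by (simp add: VV.scale_zero_left)
qed

text \<open>Connectedness is what makes the empty word, which has degree 0, a multiple of the unit.\<close>

lemma one_H: "span {1} = H 0"
proof -
  have sub: "subspace (H 0)" using grading by (simp add: grading_def)
  obtain B where B: "B \<subseteq> H 0" "independent B" "H 0 \<subseteq> span B" "card B = dim (H 0)"
    by (rule basis_exists)
  then obtain b where "B = {b}"
    using connected by (auto simp: card_1_singleton_iff)
  with B one_graded obtain c where c: "1 = scale c b"
    by (auto simp: span_singleton)
  have "c \<noteq> 0" using c by auto
  then have "b = scale (inverse c) 1" by (simp add: c)
  then have "b \<in> span {1}" by (simp add: span_singleton)
  then have "H 0 \<subseteq> span {1}"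
    using B \<open>B = {b}\<close> span_minimal[of "{b}" "span {1}"] by auto
  moreover have "span {1} \<subseteq> H 0"
    using one_graded sub by (intro span_minimal) auto
  ultimately show ?thesis by simp
qed

lemma word_Nil: "word [] = 1"
proof -
  have "word [] \<in> span {1}"
    using word_graded[of "[]" "[]"] by (simp add: one_H)
  then obtain c where c: "word [] = scale c 1"
    by (auto simp: span_singleton)
  have "c = counit (word [])"
    by (simp add: c linear_scaleD[OF counit_linear] counit_one)
  then have "c = 1" by (simp only: counit_word) simp
  then show ?thesis by (simp add: c)
qed

lemma comult_word:
  "tensor2_eq scale (comult (word xs)) (\<Sum>i\<le>length xs. pure (word (take i xs), word (drop i xs)))"
proof -
  let ?F = "lin_ext free_scale (\<lambda>(us, vs). pure (word us, word vs))"
  have "tensor2_eq scale (comult (\<phi> (pure xs))) (?F (deconcatenation (pure xs)))"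
    using iso by (simp add: deconcatenation_iso_def word_def)
  also have "deconcatenation (pure xs) = (\<Sum>i\<le>length xs. pure (take i xs, drop i xs))"
    by (simp add: deconcatenation_def vector_space_free_scale)
  also have "?F \<dots> = (\<Sum>i\<le>length xs. pure (word (take i xs), word (drop i xs)))"
    by (simp add: linear_sumD[OF linear_lin_ext[OF vector_space_free_scale]] vector_space_free_scale)
  finally show ?thesis by (simp add: word_def)
qed

text \<open>Sweedler notation evaluated on words. Together with the formula for products below, this turns the
axioms on formal tensors into finite sums over splittings of words.\<close>

lemma sweedler_word:
  assumes "bilinear_map scale s \<beta>"
  shows "lin_ext s (\<lambda>(a, b). \<beta> a b) (comult (word xs)) =
    (\<Sum>i\<le>length xs. \<beta> (word (take i xs)) (word (drop i xs)))"
proof -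
  have s: "vector_space s"
    using assms by (auto simp: bilinear_map_def Vector_Spaces.linear_iff)
  show ?thesis
    by (subst tensor2_eq_lin_ext[OF assms comult_word])
      (simp add: linear_sumD[OF linear_lin_ext[OF s]] s)
qed

lemma sweedler_word_mult:
  assumes \<beta>: "bilinear_map scale s \<beta>"
  shows "lin_ext s (\<lambda>(a, b). \<beta> a b) (comult (word xs * word ys)) =
    (\<Sum>i\<le>length xs. \<Sum>j\<le>length ys.
      \<beta> (word (take i xs) * word (take j ys)) (word (drop i xs) * word (drop j ys)))"
proof -
  have l: "Vector_Spaces.linear scale s (\<lambda>x. \<beta> x y)"
    and r: "Vector_Spaces.linear scale s (\<beta> x)" for x y
    using \<beta> by (auto simp: bilinear_map_def)
  then have s: "vector_space s"
    by (auto simp: Vector_Spaces.linear_iff)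
  interpret s: vector_space s by (rule s)
  have bl: "bilinear_map scale s (\<lambda>a b. \<beta> (a * c) (b * d))"
    and br: "bilinear_map scale s (\<lambda>c d. \<beta> (a * c) (b * d))" for a b c d
    unfolding bilinear_map_def Vector_Spaces.linear_iff
    using s vector_space_H
    by (auto simp: distrib_left distrib_right scale_mult_left scale_mult_right
        linear_addD[OF l] linear_addD[OF r] linear_scaleD[OF l] linear_scaleD[OF r])
  have b2: "bilinear_map scale s (\<lambda>a b. \<Sum>j\<le>length ys. \<beta> (a * word (take j ys)) (b * word (drop j ys)))"
    unfolding bilinear_map_def Vector_Spaces.linear_iff
    using s vector_space_H
    by (auto simp: distrib_left distrib_right scale_mult_left scale_mult_right sum.distrib
        s.scale_sum_right
        linear_addD[OF l] linear_addD[OF r] linear_scaleD[OF l] linear_scaleD[OF r])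
  have "lin_ext s (\<lambda>(a, b). \<beta> a b) (comult (word xs * word ys)) =
    lin_ext s (\<lambda>(a, b). lin_ext s (\<lambda>(c, d). \<beta> (a * c) (b * d)) (comult (word ys)))
      (comult (word xs))"
    by (subst tensor2_eq_lin_ext[OF \<beta> comult_mult])
      (simp add: linear_lin_ext_comp[OF linear_lin_ext[OF s]] split_def s)
  also have "\<dots> = lin_ext s (\<lambda>(a, b). \<Sum>j\<le>length ys. \<beta> (a * word (take j ys)) (b * word (drop j ys)))
      (comult (word xs))"
    by (simp add: sweedler_word[OF br])
  also have "\<dots> = (\<Sum>i\<le>length xs. \<Sum>j\<le>length ys.
      \<beta> (word (take i xs) * word (take j ys)) (word (drop i xs) * word (drop j ys)))"
    by (rule sweedler_word[OF b2])
  finally show ?thesis .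
qed

definition letter :: "'v \<Rightarrow> 'a"
  where "letter v = word [v]"

lemma linear_letter: "Vector_Spaces.linear scaleV scale letter"
  using linear_word_slot[of "[]" "[]"] by (simp add: letter_def[abs_def])

lemma inj_letter: "inj letter"
proof (rule injI)
  fix v w assume "letter v = letter w"
  then have eq: "tensor_eq scaleV (pure [v]) (pure [w])"
    by (simp add: letter_def word_def phi_eq_iff)
  define f where "f = (\<lambda>xs. if length xs = 1 then xs ! 0 else (0 :: 'v))"
  have "f (us @ [scaleV a x + scaleV b y] @ vs) =
      scaleV a (f (us @ [x] @ vs)) + scaleV b (f (us @ [y] @ vs))" for us vs x y a b
    by (auto simp: f_def VV.scale_zero_right)
  from tensor_eq_lin_ext[OF vector_space_V vector_space_V this eq]
  show "v = w" by (simp add: vector_space_V f_def)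
qed

lemma letter_primitive: "letter v \<in> primitives"
proof -
  have "{..length [v]} = {0, 1}" by auto
  then show ?thesis
    using comult_word[of "[v]"] by (simp add: primitives_def letter_def word_Nil)
qed

end

section \<open>Coordinates with respect to a basis of words\<close>

locale cofree_hopf_algebra_basis = cofree_hopf_algebra scale comult counit H scaleV V \<phi>
  for scale :: "'k::field \<Rightarrow> 'a::ring_1 \<Rightarrow> 'a"
    and comult :: "'a \<Rightarrow> ('a \<times> 'a \<Rightarrow>\<^sub>0 'k)"
    and counit :: "'a \<Rightarrow> 'k"
    and H :: "nat \<Rightarrow> 'a set"
    and scaleV :: "'k \<Rightarrow> 'v::ab_group_add \<Rightarrow> 'v"
    and V :: "nat \<Rightarrow> 'v set"
    and \<phi> :: "('v list \<Rightarrow>\<^sub>0 'k) \<Rightarrow> 'a" +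
  fixes C :: "'v set"
  assumes independent_C: "VV.independent C" and span_C: "VV.span C = UNIV"
begin

definition letter_coeff :: "'v \<Rightarrow> 'v \<Rightarrow> 'k"
  where "letter_coeff c x = VV.representation C x c"

lemma linear_letter_coeff: "Vector_Spaces.linear scaleV (*) (letter_coeff c)"
  unfolding letter_coeff_def[abs_def] by (rule VV.linear_representation[OF independent_C span_C])

lemma letter_coeff_basis: "x \<in> C \<Longrightarrow> letter_coeff c x = (if c = x then 1 else 0)"
  by (simp add: letter_coeff_def VV.representation_basis[OF independent_C])

text \<open>For a word \<open>z\<close> over the basis \<open>C\<close>, the coordinate function of the tensor power of \<open>V\<close> dual to the
basis tensor \<open>z\<close>, evaluated on pure tensors.\<close>

fun tensor_coeff :: "'v list \<Rightarrow> 'v list \<Rightarrow> 'k" where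
  "tensor_coeff [] [] = 1"
| "tensor_coeff (c # z) (x # xs) = letter_coeff c x * tensor_coeff z xs"
| "tensor_coeff _ _ = 0"

lemma tensor_coeff_Nil: "tensor_coeff [] xs = (if xs = [] then 1 else 0)"
  by (cases xs) auto

lemma tensor_coeff_Nil2: "tensor_coeff z [] = (if z = [] then 1 else 0)"
  by (cases z) auto

lemma tensor_coeff_basis:
  "set xs \<subseteq> C \<Longrightarrow> tensor_coeff z xs = (if z = xs then 1 else 0)"
  by (induction z xs rule: tensor_coeff.induct) (auto simp: letter_coeff_basis)

lemma tensor_coeff_multilinear:
  "tensor_coeff z (us @ [scaleV a x + scaleV b y] @ vs) =
    a * tensor_coeff z (us @ [x] @ vs) + b * tensor_coeff z (us @ [y] @ vs)"
proof (induction us arbitrary: z)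
  case Nil
  then show ?case
    by (cases z)
      (auto simp: linear_addD[OF linear_letter_coeff] linear_scaleD[OF linear_letter_coeff] algebra_simps)
next
  case (Cons u us)
  then show ?case
    by (cases z) (auto simp: algebra_simps)
qed

text \<open>Deconcatenation is dual to concatenation. At most the summand with \<open>i = length u\<close> is nonzero; the
sum over all splittings is the form in which the coproduct produces it.\<close>

lemma tensor_coeff_append:
  "tensor_coeff (u @ v) xs = (\<Sum>i\<le>length xs. tensor_coeff u (take i xs) * tensor_coeff v (drop i xs))"
proof (induction u arbitrary: xs)
  case Nil
  have "(\<Sum>i\<le>length xs. tensor_coeff [] (take i xs) * tensor_coeff v (drop i xs)) =
      (\<Sum>i\<le>length xs. if i = 0 then tensor_coeff v xs else 0)"
    by (rule sum.cong) (auto simp: tensor_coeff_Nil)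
  then show ?case by simp
next
  case (Cons c u)
  then show ?case
    by (cases xs) (simp_all add: sum.atMost_Suc_shift sum_distrib_left mult.assoc del: sum.atMost_Suc)
qed

text \<open>The choice of a preimage under \<open>\<phi>\<close> is harmless, because \<open>\<phi>\<close> identifies exactly the tensors that are
equal modulo the multilinearity relations.\<close>

definition coord :: "'v list \<Rightarrow> 'a \<Rightarrow> 'k"
  where "coord z y = lin_ext (*) (tensor_coeff z) (SOME t. \<phi> t = y)"

lemma coord_phi: "coord z (\<phi> t) = lin_ext (*) (tensor_coeff z) t"
proof -
  have "\<phi> (SOME u. \<phi> u = \<phi> t) = \<phi> t"
    using someI[of "\<lambda>u. \<phi> u = \<phi> t" t] by simp
  then show ?thesis
    unfolding coord_def phi_eq_iff
    by (rule tensor_eq_lin_ext[OF vector_space_V vector_space_field tensor_coeff_multilinear])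
qed

lemma coord_word: "coord z (word xs) = tensor_coeff z xs"
  by (simp add: word_def coord_phi vector_space_field)

lemma phi_surj: obtains t where "y = \<phi> t"
proof -
  have "range \<phi> = UNIV" using iso by (simp add: deconcatenation_iso_def)
  then have "y \<in> range \<phi>" by simp
  then show ?thesis by (rule rangeE) (rule that)
qed

lemma linear_coord: "Vector_Spaces.linear scale (*) (coord z)"
  unfolding Vector_Spaces.linear_iff
proof (intro conjI allI vector_space_field vector_space_H)
  show "coord z (x + y) = coord z x + coord z y" for x y
  proof -
    obtain t where x: "x = \<phi> t" by (rule phi_surj)
    obtain u where y: "y = \<phi> u" by (rule phi_surj)
    show ?thesis
      unfolding x y linear_addD[OF linear_phi, symmetric] coord_phi
      by (rule linear_addD[OF linear_lin_ext[OF vector_space_field]])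
  qed
  show "coord z (scale c x) = c * coord z x" for c x
  proof -
    obtain t where x: "x = \<phi> t" by (rule phi_surj)
    show ?thesis
      unfolding x linear_scaleD[OF linear_phi, symmetric] coord_phi
      by (rule linear_scaleD[OF linear_lin_ext[OF vector_space_field]])
  qed
qed

lemmas coord_simps = linear_addD[OF linear_coord] linear_scaleD[OF linear_coord]
  linear_sumD[OF linear_coord] linear_diffD[OF linear_coord] linear_zeroD[OF linear_coord]

lemma bilinear_map_coord: "bilinear_map scale (*) (\<lambda>a b. coord u a * coord v b)"
  unfolding bilinear_map_def Vector_Spaces.linear_iff
  using vector_space_field vector_space_H by (auto simp: coord_simps algebra_simps)

text \<open>The letters of a word are expanded in the basis \<open>C\<close> from left to right; \<open>us\<close> is the part that has
already been expanded.\<close>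

lemma word_in_span: "word xs \<in> span (word ` lists C)"
proof -
  have "word (us @ xs) \<in> span (word ` lists C)" if "us \<in> lists C" for us
    using that
  proof (induction xs arbitrary: us)
    case Nil
    then show ?case by (auto intro: span_base)
  next
    case (Cons x xs)
    interpret L: Vector_Spaces.linear scaleV scale "\<lambda>x. word (us @ [x] @ xs)"
      by (rule linear_word_slot)
    have "x \<in> VV.span C" by (simp add: span_C)
    then show ?case
    proof (induction rule: VV.span_induct)
      case base
      show ?case
        using L.subspace_vimage[OF subspace_span[of "word ` lists C"]]
        by (simp add: vimage_def)
    next
      case (step c)
      then show ?case
        using Cons.IH[of "us @ [c]"] Cons.prems by simp
    qed
  qed
  from this[of "[]"] show ?thesis by simp
qed

lemma span_words: "span (word ` lists C) = UNIV"
proof -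
  have "y \<in> span (word ` lists C)" for y
  proof -
    obtain t where y: "y = \<phi> t" by (rule phi_surj)
    have "lin_ext scale word t \<in> span (word ` lists C)"
      unfolding lin_ext_def by (rule span_sum, rule span_scale, rule word_in_span)
    then show ?thesis by (simp only: y phi_eq_lin_ext)
  qed
  then show ?thesis by blast
qed

lemma coord_basis: "w \<in> lists C \<Longrightarrow> coord z (word w) = (if z = w then 1 else 0)"
  by (auto simp: coord_word tensor_coeff_basis lists_eq_set)

lemma inj_word: "inj_on word (lists C)"
  by (rule inj_onI) (metis coord_basis zero_neq_one)

lemma coord_sum_words:
  assumes "finite F" "F \<subseteq> lists C"
  shows "coord z (\<Sum>w\<in>F. scale (r w) (word w)) = (if z \<in> F then r z else 0)"
proof -
  have "coord z (\<Sum>w\<in>F. scale (r w) (word w)) = (\<Sum>w\<in>F. if w = z then r w else 0)"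
    unfolding coord_simps
    by (rule sum.cong) (use subsetD[OF assms(2)] in \<open>auto simp: coord_basis simp del: in_lists_conv_set\<close>)
  then show ?thesis using assms(1) by simp
qed

lemma span_words_explicit:
  assumes "T \<subseteq> word ` lists C" "finite T"
  obtains F where "finite F" "F \<subseteq> lists C" "T = word ` F" "inj_on word F"
proof -
  obtain F where F: "F \<subseteq> lists C" "T = word ` F"
    using assms(1) by (auto simp: subset_image_iff)
  have inj: "inj_on word F" using inj_word F(1) by (rule inj_on_subset)
  then have "finite F" using assms(2) F(2) by (simp add: finite_image_iff)
  with F inj that show ?thesis by blast
qed

lemma coord_expansion:
  obtains F where "finite F" "F \<subseteq> lists C" "y = (\<Sum>z\<in>F. scale (coord z y) (word z))"
proof -
  have "y \<in> span (word ` lists C)" by (simp add: span_words)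
  then obtain T r where T: "finite T" "T \<subseteq> word ` lists C" "y = (\<Sum>a\<in>T. scale (r a) a)"
    by (auto simp: span_explicit)
  obtain F where F: "finite F" "F \<subseteq> lists C" "T = word ` F" "inj_on word F"
    using span_words_explicit[OF T(2,1)] .
  have y: "y = (\<Sum>w\<in>F. scale (r (word w)) (word w))"
    using T(3) F(4) by (simp add: F(3) sum.reindex)
  have c: "coord z y = (if z \<in> F then r (word z) else 0)" for z
    by (subst y) (rule coord_sum_words[OF F(1,2)])
  have "(\<Sum>w\<in>F. scale (r (word w)) (word w)) = (\<Sum>z\<in>F. scale (coord z y) (word z))"
    by (rule sum.cong) (simp_all only: c if_True)
  with y have "y = (\<Sum>z\<in>F. scale (coord z y) (word z))" by (rule trans)
  then show ?thesis by (rule that[OF F(1,2)])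
qed

lemma independent_words: "independent (word ` lists C)"
  unfolding independent_explicit_module
proof (intro allI impI)
  fix T r a
  assume T: "finite T" "T \<subseteq> word ` lists C" "(\<Sum>a\<in>T. scale (r a) a) = 0" "a \<in> T"
  obtain F where F: "finite F" "F \<subseteq> lists C" "T = word ` F" "inj_on word F"
    using span_words_explicit[OF T(2,1)] .
  from T(4) F(3) obtain z where z: "z \<in> F" "a = word z" by auto
  have "r (word z) = coord z (\<Sum>w\<in>F. scale (r (word w)) (word w))"
    using z(1) by (simp add: coord_sum_words[OF F(1,2), where r = "\<lambda>w. r (word w)"])
  also have "\<dots> = 0"
    using T(3) F(4) by (simp add: F(3) sum.reindex linear_zeroD[OF linear_coord])
  finally show "r a = 0" by (simp add: z)
qed

text \<open>The key formula of the coordinate approach: the coproduct of \<open>y\<close> has the coordinate \<open>coord (u @ v) y\<close>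
at \<open>word u \<otimes> word v\<close>. Both sides are linear in \<open>y\<close>, so that it suffices to compare them on words.\<close>

lemma coord_append:
  "coord (u @ v) y = lin_ext (*) (\<lambda>(a, b). coord u a * coord v b) (comult y)"
proof -
  have lin: "Vector_Spaces.linear scale (*) (\<lambda>y. lin_ext (*) (\<lambda>(a, b). coord u a * coord v b) (comult y))"
    unfolding Vector_Spaces.linear_iff
    by (auto simp: vector_space_H vector_space_field tensor2_eq_lin_ext[OF bilinear_map_coord comult_add]
        tensor2_eq_lin_ext[OF bilinear_map_coord comult_scale]
        linear_addD[OF linear_lin_ext[OF vector_space_field]]
        linear_scaleD[OF linear_lin_ext[OF vector_space_field]])
  obtain F where "finite F" "F \<subseteq> lists C" and y: "y = (\<Sum>z\<in>F. scale (coord z y) (word z))"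
    by (rule coord_expansion)
  have "lin_ext (*) (\<lambda>(a, b). coord u a * coord v b) (comult (word z)) = coord (u @ v) (word z)" for z
    by (simp add: sweedler_word[OF bilinear_map_coord] coord_word tensor_coeff_append)
  then show ?thesis
    using linear_sumD[OF lin, of "\<lambda>z. scale (coord z y) (word z)" F]
      linear_sumD[OF linear_coord, of "u @ v" "\<lambda>z. scale (coord z y) (word z)" F]
    by (simp only: y[symmetric] linear_scaleD[OF lin] linear_scaleD[OF linear_coord])
qed

lemma coord_one: "coord z 1 = (if z = [] then 1 else 0)"
  using coord_word[of z "[]"] by (simp add: word_Nil tensor_coeff_Nil2)

text \<open>For a primitive \<open>y\<close>, the coordinates of the coproduct at \<open>u\<close> and \<open>v\<close> both nonempty vanish, so \<open>y\<close> has no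
coordinates at words of length at least 2. At the empty word the coordinate equals its own double.\<close>

lemma primitives_subset_letters: "primitives \<subseteq> range letter"
proof
  fix y assume "y \<in> primitives"
  then have "tensor2_eq scale (comult y) (pure (1, y) + pure (y, 1))"
    by (simp add: primitives_def)
  then have *: "coord (u @ v) y = coord u 1 * coord v y + coord u y * coord v 1" for u v
    by (simp add: coord_append[of u v] tensor2_eq_lin_ext[OF bilinear_map_coord]
        linear_addD[OF linear_lin_ext[OF vector_space_field]] vector_space_field)
  have zero: "coord z y = 0" if "length z \<noteq> 1" for z
  proof (cases z)
    case Nil
    have "coord [] y = coord [] y + coord [] y"
      using *[of "[]" "[]"] by (simp only: coord_one) simp
    then show ?thesis by (simp only: add_cancel_right_right Nil)
  next
    case (Cons a v)
    then show ?thesis using *[of "[a]" v] that by (simp add: coord_one)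
  qed
  obtain F where "finite F" "F \<subseteq> lists C" and F: "y = (\<Sum>z\<in>F. scale (coord z y) (word z))"
    by (rule coord_expansion)
  interpret L: Vector_Spaces.linear scaleV scale letter
    by (rule linear_letter)
  have sub: "subspace (range letter)"
    by (rule L.subspace_image) (rule VV.subspace_UNIV)
  have "scale (coord z y) (word z) \<in> range letter" for z
  proof (cases "length z = 1")
    case True
    then obtain v where "z = [v]" by (cases z) auto
    then show ?thesis
      using sub by (auto intro: subspace_scale simp: letter_def[symmetric])
  qed (use zero[of z] sub in \<open>auto intro: subspace_0\<close>)
  then have "(\<Sum>z\<in>F. scale (coord z y) (word z)) \<in> range letter"
    by (intro subspace_sum[OF sub])
  then show "y \<in> range letter" by (simp only: F[symmetric])
qed

end

section \<open>The product in top length\<close>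

context cofree_hopf_algebra_basis
begin

lemma coord_append_word_mult:
  "coord (y @ z) (word u * word v) =
    (\<Sum>i\<le>length u. \<Sum>j\<le>length v.
      coord y (word (take i u) * word (take j v)) * coord z (word (drop i u) * word (drop j v)))"
  by (simp add: coord_append sweedler_word_mult[OF bilinear_map_coord])

text \<open>Multiplication respects the filtration by length. Peeling the first letter off \<open>z\<close> takes at least one
letter off \<open>u\<close> and \<open>v\<close> together, because the unit has no coordinate at a word of length 1.\<close>

lemma coord_word_mult_long:
  "length z > length u + length v \<Longrightarrow> coord z (word u * word v) = 0"
proof (induction z arbitrary: u v)
  case (Cons a z)
  have "coord [a] (word (take i u) * word (take j v)) * coord z (word (drop i u) * word (drop j v)) = 0"
    if "i \<le> length u" "j \<le> length v" for i j
  proof (cases "i = 0 \<and> j = 0")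
    case True
    then show ?thesis by (simp add: word_Nil coord_one)
  next
    case False
    then show ?thesis
      using that Cons.prems by (intro mult_eq_0_iff[THEN iffD2] disjI2 Cons.IH) auto
  qed
  then show ?case
    using coord_append_word_mult[of "[a]" z u v] by (simp del: mult_eq_0_iff)
qed simp

text \<open>In top length the product is the shuffle product: when the first letter is peeled off \<open>z\<close>, exactly one
letter is taken off \<open>u\<close> and \<open>v\<close> together. With none taken off, the left factor is the unit, which has no
coordinate at a word of length 1; with two or more, the right factor is too short to reach the rest
of \<open>z\<close>.\<close>

lemma coord_Cons_word_mult:
  assumes "length z + 1 \<ge> length u + length v"
  shows "coord (a # z) (word u * word v) =
    (if u = [] then 0 else letter_coeff a (hd u) * coord z (word (tl u) * word v)) +
    (if v = [] then 0 else letter_coeff a (hd v) * coord z (word u * word (tl v)))"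
    (is "_ = ?L + ?R")
proof -
  have "coord [a] (word (take i u) * word (take j v)) * coord z (word (drop i u) * word (drop j v)) =
      (if i = 1 then if j = 0 then ?L else 0 else 0) + (if i = 0 then if j = 1 then ?R else 0 else 0)"
    if "i \<le> length u" "j \<le> length v" for i j
  proof -
    consider "i = 0" "j = 0" | "i = 1" "j = 0" | "i = 0" "j = 1" | "i + j \<ge> 2" by linarith
    then show ?thesis
    proof cases
      case 1
      then show ?thesis by (simp add: word_Nil coord_one)
    next
      case 2
      with that show ?thesis
        by (cases u) (auto simp: word_Nil coord_word drop_Suc)
    next
      case 3
      with that show ?thesis
        by (cases v) (auto simp: word_Nil coord_word drop_Suc)
    next
      case 4
      then have "coord z (word (drop i u) * word (drop j v)) = 0"
        using that assms by (intro coord_word_mult_long) auto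
      with 4 show ?thesis by auto
    qed
  qed
  then have "coord (a # z) (word u * word v) = (\<Sum>i\<le>length u. \<Sum>j\<le>length v.
      (if i = 1 then if j = 0 then ?L else 0 else 0) + (if i = 0 then if j = 1 then ?R else 0 else 0))"
    using coord_append_word_mult[of "[a]" z u v] by simp
  also have "\<dots> = (\<Sum>i\<le>length u. if i = 1 then ?L else 0) + (\<Sum>i\<le>length u. if i = 0 then ?R else 0)"
    unfolding sum.distrib
    by (intro arg_cong2[where f = "(+)"] sum.cong refl) (auto simp: Suc_le_eq)
  also have "\<dots> = ?L + ?R"
    by (auto simp: Suc_le_eq)
  finally show ?thesis .
qed

text \<open>This is the identity that makes signed reversal the antipode of the shuffle algebra. By the shuffle
recursion, the \<open>i\<close>-th summand is the sum of a term that uses the \<open>i\<close>-th letter of \<open>w\<close> and one that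
uses the next letter; the sum telescopes.\<close>

lemma alternating_sum_rev_take_mult_drop:
  assumes "w \<noteq> []" "length z \<ge> length w"
  shows "(\<Sum>i\<le>length w. (-1) ^ i * coord z (word (rev (take i w)) * word (drop i w))) = 0"
proof -
  define n where "n = length w"
  obtain a z' where z: "z = a # z'" "length z' + 1 \<ge> n"
    using assms by (cases z) (auto simp: n_def)
  \<comment> \<open>\<open>B i\<close> takes the letter \<open>w ! i\<close>: it is the right part of summand \<open>i\<close> and the left part of summand \<open>Suc i\<close>.\<close>
  define B where "B = (\<lambda>i. letter_coeff a (w ! i) *
    coord z' (word (rev (take i w)) * word (drop (Suc i) w)))"
  have step: "coord z (word (rev (take i w)) * word (drop i w)) =
      (if i = 0 then 0 else B (i - 1)) + (if i = n then 0 else B i)" if "i \<le> n" for i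
  proof -
    have *: "rev (take i w) = (w ! (i - 1)) # rev (take (i - 1) w)" if "i \<noteq> 0"
      using that \<open>i \<le> n\<close> take_Suc_conv_app_nth[of "i - 1" w] by (simp add: n_def)
    have d: "drop i w = w ! i # drop (Suc i) w" if "i \<noteq> n"
      using that \<open>i \<le> n\<close> by (simp add: Cons_nth_drop_Suc n_def)
    have "coord z (word (rev (take i w)) * word (drop i w)) =
      (if rev (take i w) = [] then 0 else letter_coeff a (hd (rev (take i w))) *
        coord z' (word (tl (rev (take i w))) * word (drop i w))) +
      (if drop i w = [] then 0 else letter_coeff a (hd (drop i w)) *
        coord z' (word (rev (take i w)) * word (tl (drop i w))))"
      unfolding z(1) by (rule coord_Cons_word_mult) (use z(2) that in \<open>auto simp: n_def\<close>)
    also have "\<dots> = (if i = 0 then 0 else B (i - 1)) + (if i = n then 0 else B i)"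
      using that assms(1) * d
      by (intro arg_cong2[where f = "(+)"]) (auto simp: B_def n_def)
    finally show ?thesis .
  qed
  obtain k where k: "n = Suc k" using assms(1) by (cases n) (auto simp: n_def)
  have "(\<Sum>i\<le>n. (-1) ^ i * coord z (word (rev (take i w)) * word (drop i w))) =
      (\<Sum>i\<le>n. (-1) ^ i * (if i = 0 then 0 else B (i - 1))) + (\<Sum>i\<le>n. (-1) ^ i * (if i = n then 0 else B i))"
    by (simp add: step distrib_left sum.distrib)
  also have "(\<Sum>i\<le>n. (-1) ^ i * (if i = 0 then 0 else B (i - 1))) = (\<Sum>i\<le>k. - ((-1) ^ i * B i))"
    unfolding k by (subst sum.atMost_Suc_shift) simp
  also have "(\<Sum>i\<le>n. (-1) ^ i * (if i = n then 0 else B i)) = (\<Sum>i\<le>k. (-1) ^ i * B i)"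
    unfolding k sum.atMost_Suc by simp
  finally show ?thesis by (simp add: n_def sum_negf)
qed

end

section \<open>The antipode in top length\<close>

locale cofree_hopf_algebra_antipode = cofree_hopf_algebra_basis scale comult counit H scaleV V \<phi> C
  for scale :: "'k::field \<Rightarrow> 'a::ring_1 \<Rightarrow> 'a"
    and comult :: "'a \<Rightarrow> ('a \<times> 'a \<Rightarrow>\<^sub>0 'k)"
    and counit :: "'a \<Rightarrow> 'k"
    and H :: "nat \<Rightarrow> 'a set"
    and scaleV :: "'k \<Rightarrow> 'v::ab_group_add \<Rightarrow> 'v"
    and V :: "nat \<Rightarrow> 'v set"
    and \<phi> :: "('v list \<Rightarrow>\<^sub>0 'k) \<Rightarrow> 'a"
    and C :: "'v set" +
  fixes S :: "'a \<Rightarrow> 'a"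
  assumes antipode: "is_antipode S"
begin

lemma linear_S: "Vector_Spaces.linear scale scale S"
  using antipode by (simp add: is_antipode_def)

lemma antipode_word:
  "(\<Sum>i\<le>length w. S (word (take i w)) * word (drop i w)) = (if w = [] then 1 else 0)"
proof -
  have "bilinear_map scale scale (\<lambda>a b. S a * b)"
    unfolding bilinear_map_def Vector_Spaces.linear_iff
    by (auto simp: vector_space_H linear_addD[OF linear_S] linear_scaleD[OF linear_S]
        distrib_left distrib_right scale_mult_left scale_mult_right)
  from sweedler_word[OF this, of w] show ?thesis
    using antipode by (auto simp: is_antipode_def counit_word)
qed

lemma S_one: "S 1 = 1"
  using antipode_word[of "[]"] by (simp add: word_Nil)

lemma S_word_recursion:
  assumes "w \<noteq> []"
  shows "S (word w) = - (\<Sum>i<length w. S (word (take i w)) * word (drop i w))"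
proof -
  have "{..length w} = insert (length w) {..<length w}" by auto
  then show ?thesis
    using antipode_word[of w] assms by (simp add: word_Nil eq_neg_iff_add_eq_0)
qed

text \<open>An element of filtration degree less than \<open>n\<close>, multiplied by a word, does not reach length
\<open>n + length v\<close>; so lower order errors in the antipode of a prefix can be ignored.\<close>

lemma coord_mult_word_low:
  assumes low: "\<And>z. z \<in> lists C \<Longrightarrow> length z \<ge> n \<Longrightarrow> coord z y = 0"
    and "length z \<ge> n + length v"
  shows "coord z (y * word v) = 0"
proof -
  obtain F where F: "finite F" "F \<subseteq> lists C" "y = (\<Sum>u\<in>F. scale (coord u y) (word u))"
    by (rule coord_expansion)
  have "coord u y * coord z (word u * word v) = 0" if "u \<in> F" for u
  proof (cases "length u \<ge> n")
    case True
    then show ?thesis using low[of u] F(2) that by auto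
  next
    case False
    then show ?thesis using assms(2) by (simp add: coord_word_mult_long)
  qed
  then have "coord z ((\<Sum>u\<in>F. scale (coord u y) (word u)) * word v) = 0"
    by (simp add: sum_distrib_right scale_mult_left coord_simps del: mult_eq_0_iff)
  then show ?thesis by (simp only: F(3)[symmetric])
qed

text \<open>Modulo shorter words the antipode is signed reversal. In the recursion for the antipode of \<open>w\<close>, the
antipodes of the proper prefixes may be replaced by their signed reversals, and what results is the
telescoping sum without its last term.\<close>

lemma coord_antipode_word:
  "length z \<ge> length w \<Longrightarrow> coord z (S (word w)) = (-1) ^ length w * coord z (word (rev w))"
proof (induction "length w" arbitrary: w z rule: less_induct)
  case less
  show ?case
  proof (cases "w = []")
    case True
    then show ?thesis by (simp add: word_Nil S_one)
  next
    case False
    define m where "m = (\<lambda>i. coord z (word (rev (take i w)) * word (drop i w)))"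
    \<comment> \<open>Replacing the antipode of a prefix by its signed reversal does not change the top coordinates.\<close>
    have m: "coord z (S (word (take i w)) * word (drop i w)) = (-1) ^ i * m i" if "i < length w" for i
    proof -
      let ?y = "S (word (take i w)) - scale ((-1) ^ i) (word (rev (take i w)))"
      have "coord z (?y * word (drop i w)) = 0"
      proof (rule coord_mult_word_low[of i])
        show "coord z' ?y = 0" if "i \<le> length z'" for z'
          using less.hyps[of "take i w" z'] that \<open>i < length w\<close> by (simp add: coord_simps min_def)
      qed (use that less.prems in auto)
      then show ?thesis
        by (simp add: left_diff_distrib scale_mult_left coord_simps m_def)
    qed
    have split: "{..length w} = insert (length w) {..<length w}" by auto
    have "coord z (S (word w)) = - (\<Sum>i<length w. (-1) ^ i * m i)"
      by (simp add: S_word_recursion[OF False] linear_diffD[OF linear_coord, of z 0, simplified]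
          coord_simps m)
    also have "\<dots> = (-1) ^ length w * m (length w)"
      using alternating_sum_rev_take_mult_drop[OF False less.prems]
      by (simp add: split m_def add_eq_0_iff)
    finally show ?thesis by (simp add: m_def word_Nil)
  qed
qed

lemma S_word_graded:
  assumes "list_all2 (\<lambda>x n. x \<in> V n) w ns"
  shows "S (word w) \<in> H (sum_list ns)"
  using assms
proof (induction "length w" arbitrary: w ns rule: less_induct)
  case less
  have sub: "subspace (H n)" for n using grading by (simp add: grading_def)
  show ?case
  proof (cases "w = []")
    case True
    then show ?thesis using less.prems one_graded by (simp add: word_Nil S_one)
  next
    case False
    have "S (word (take i w)) * word (drop i w) \<in> H (sum_list ns)" if "i < length w" for i
    proof -
      have "S (word (take i w)) * word (drop i w) \<in> H (sum_list (take i ns) + sum_list (drop i ns))"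
        by (intro mult_graded less.hyps word_graded)
          (use less.prems that in \<open>auto intro: list_all2_takeI list_all2_dropI\<close>)
      also have "sum_list (take i ns) + sum_list (drop i ns) = sum_list ns"
        by (metis append_take_drop_id sum_list_append)
      finally show ?thesis .
    qed
    then show ?thesis
      unfolding S_word_recursion[OF False]
      by (intro subspace_neg[OF sub] subspace_sum[OF sub]) auto
  qed
qed

end

section \<open>Words over a homogeneous basis of the primitive elements\<close>

context graded_connected_hopf_algebra
begin

lemma subspace_H: "subspace (H n)"
  using grading by (simp add: grading_def)

lemma letter_weight_eq:
  assumes "b \<in> H n" "b \<noteq> 0"
  shows "letter_weight H b = n"
  unfolding letter_weight_def
proof (rule the_equality)
  fix k assume "b \<in> H k"
  then show "k = n"
    using grading_decomposition_unique(1)[OF grading vector_space_axioms, of "{n}" "\<lambda>_. b" k] assms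
    by (auto split: if_splits)
qed (rule assms)

end

context cofree_hopf_algebra
begin

text \<open>An arbitrary basis of \<open>V\<close> serves to compute the primitive elements; the given basis \<open>B\<close> of primitives
can be pulled back to \<open>V\<close> only after that.\<close>

lemma range_letter: "range letter = primitives"
proof -
  obtain C where C: "VV.independent C" "UNIV \<subseteq> VV.span C"
    by (rule VV.basis_exists[of UNIV])
  then interpret cofree_hopf_algebra_basis scale comult counit H scaleV V \<phi> C
    by unfold_locales auto
  show ?thesis
    using primitives_subset_letters letter_primitive by auto
qed

text \<open>The homogeneous components of \<open>v\<close> are mapped to homogeneous components of \<open>letter v\<close>, and \<open>letter\<close> is
injective.\<close>

lemma letter_in_H_imp_in_V:
  assumes "letter v \<in> H n"
  shows "v \<in> V n"
proof -
  obtain g where g: "\<And>n. g n \<in> V n" "finite {n. g n \<noteq> 0}" and v: "v = (\<Sum>n | g n \<noteq> 0. g n)"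
    using grading_V unfolding grading_def by meson
  have l0: "letter 0 = 0"
    by (rule linear_zeroD[OF linear_letter])
  have letter_eq_0: "letter x = 0 \<Longrightarrow> x = 0" for x
    using injD[OF inj_letter, of x 0] l0 by simp
  have "g k = 0" if "k \<noteq> n" for k
  proof (rule ccontr)
    assume "g k \<noteq> 0"
    have "letter (g k) = 0"
    proof (rule grading_decomposition_unique(2)[OF grading vector_space_H g(2)])
      show "letter (g n) \<in> H n" for n
        using word_graded[of "[g n]" "[n]"] g(1) by (simp add: letter_def)
      show "(\<Sum>n | g n \<noteq> 0. letter (g n)) \<in> H n"
        using assms v by (simp add: linear_sumD[OF linear_letter])
    qed (use \<open>g k \<noteq> 0\<close> that in auto)
    with \<open>g k \<noteq> 0\<close> letter_eq_0 show False by blast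
  qed
  then have "v = (\<Sum>k\<in>{n}. g k)"
    unfolding v by (intro sum.mono_neutral_left) auto
  then show ?thesis using g(1) by simp
qed

lemma basis_of_letters:
  assumes B: "homogeneous_basis_of_primitives B"
  shows "VV.independent (letter -` B)" "VV.span (letter -` B) = UNIV" "letter ` (letter -` B) = B"
proof -
  interpret L: Vector_Spaces.linear scaleV scale letter
    by (rule linear_letter)
  have B: "independent B" "span B = range letter"
    using B by (auto simp: homogeneous_basis_of_primitives_def range_letter)
  show img: "letter ` (letter -` B) = B"
    using B(2) span_superset[of B] by auto
  show "VV.independent (letter -` B)"
  proof
    assume "VV.dependent (letter -` B)"
    then obtain v where v: "letter v \<in> B" "v \<in> VV.span (letter -` B - {v})"
      by (auto simp: VV.dependent_def)
    have "letter v \<in> span (letter ` (letter -` B - {v}))"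
      unfolding L.span_image using v(2) by (rule imageI)
    moreover have "letter ` (letter -` B - {v}) \<subseteq> B - {letter v}"
      using inj_letter by (auto dest: injD)
    ultimately have "letter v \<in> span (B - {letter v})"
      using span_mono by blast
    with v(1) B(1) show False
      by (auto simp: dependent_def)
  qed
  show "VV.span (letter -` B) = UNIV"
  proof -
    have "letter ` VV.span (letter -` B) = range letter"
      using L.span_image[of "letter -` B"] img B(2) by simp
    then show ?thesis
      using inj_letter by (simp add: inj_image_eq_iff)
  qed
qed

end

locale cofree_hopf_algebra_primitive_basis = cofree_hopf_algebra scale comult counit H scaleV V \<phi>
  for scale :: "'k::field \<Rightarrow> 'a::ring_1 \<Rightarrow> 'a"
    and comult :: "'a \<Rightarrow> ('a \<times> 'a \<Rightarrow>\<^sub>0 'k)"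
    and counit :: "'a \<Rightarrow> 'k"
    and H :: "nat \<Rightarrow> 'a set"
    and scaleV :: "'k \<Rightarrow> 'v::ab_group_add \<Rightarrow> 'v"
    and V :: "nat \<Rightarrow> 'v set"
    and \<phi> :: "('v list \<Rightarrow>\<^sub>0 'k) \<Rightarrow> 'a" +
  fixes S :: "'a \<Rightarrow> 'a" and B :: "'a set"
  assumes antipode: "is_antipode S"
    and B: "homogeneous_basis_of_primitives B"
begin

sublocale cofree_hopf_algebra_antipode scale comult counit H scaleV V \<phi> "letter -` B" S
  by unfold_locales (use basis_of_letters[OF B] antipode in auto)

definition weight :: "'v list \<Rightarrow> nat"
  where "weight z = sum_list (map (\<lambda>v. letter_weight H (letter v)) z)"

lemma list_all2_weight:
  assumes "z \<in> lists (letter -` B)"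
  shows "list_all2 (\<lambda>x n. x \<in> V n) z (map (\<lambda>v. letter_weight H (letter v)) z)"
proof -
  have "v \<in> V (letter_weight H (letter v))" if v: "letter v \<in> B" for v
  proof -
    have "B \<subseteq> (\<Union>n. H n)"
      using B by (simp add: homogeneous_basis_of_primitives_def)
    then obtain n where n: "letter v \<in> H n"
      using v by blast
    have "letter v \<noteq> 0"
      using v B dependent_zero by (auto simp: homogeneous_basis_of_primitives_def)
    then show ?thesis
      using letter_in_H_imp_in_V[OF n] letter_weight_eq[OF n] by simp
  qed
  then show ?thesis
    using assms by (auto simp: list_all2_conv_all_nth) 
qed

lemma word_weight: "z \<in> lists (letter -` B) \<Longrightarrow> word z \<in> H (weight z)"
  unfolding weight_def by (intro word_graded list_all2_weight)

lemma S_word_weight: "z \<in> lists (letter -` B) \<Longrightarrow> S (word z) \<in> H (weight z)"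
  unfolding weight_def by (intro S_word_graded list_all2_weight)

text \<open>Words are homogeneous, so collecting the expansion of \<open>y\<close> by weight gives the homogeneous
decomposition of \<open>y\<close>: only the words of weight \<open>m\<close> contribute. With \<open>Z\<close> all words of weight \<open>m\<close>, this
shows that they span; with \<open>Z\<close> the short ones, it controls lower order terms.\<close>

lemma homogeneous_in_span:
  assumes y: "y \<in> H m"
    and Z: "\<And>z. z \<in> lists (letter -` B) \<Longrightarrow> weight z = m \<Longrightarrow> coord z y \<noteq> 0 \<Longrightarrow> z \<in> Z"
  shows "y \<in> span (word ` Z)"
proof -
  obtain F where F: "finite F" "F \<subseteq> lists (letter -` B)"
      and yF: "y = (\<Sum>z\<in>F. scale (coord z y) (word z))"
    by (rule coord_expansion)
  define f where "f = (\<lambda>n. \<Sum>z | z \<in> F \<and> weight z = n. scale (coord z y) (word z))"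
  have y_sum: "y = (\<Sum>n\<in>weight ` F. f n)"
    unfolding f_def using yF sum.image_gen[OF F(1), of "\<lambda>z. scale (coord z y) (word z)" weight] by simp
  have "(\<Sum>n\<in>weight ` F. f n) = (if m \<in> weight ` F then f m else 0)"
  proof (rule grading_decomposition_unique(1)[OF grading vector_space_H])
    show "f n \<in> H n" for n
      unfolding f_def
      by (intro subspace_sum[OF subspace_H] subspace_scale[OF subspace_H])
        (use word_weight[OF subsetD[OF F(2)]] in auto)
    show "(\<Sum>n\<in>weight ` F. f n) \<in> H m"
      using y y_sum by simp
  qed (use F(1) in auto)
  moreover have "f m \<in> span (word ` Z)"
    unfolding f_def
  proof (rule span_sum)
    fix z assume "z \<in> {z. z \<in> F \<and> weight z = m}"
    then show "scale (coord z y) (word z) \<in> span (word ` Z)"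
      using Z[of z] F(2) by (cases "coord z y = 0") (auto intro: span_zero span_scale span_base)
  qed
  ultimately have "(\<Sum>n\<in>weight ` F. f n) \<in> span (word ` Z)"
    by (simp add: span_zero)
  then show ?thesis by (simp only: y_sum[symmetric])
qed

text \<open>Words over \<open>B\<close> are words of primitive elements, whereas \<open>word\<close> expects letters in \<open>V\<close>.\<close>

definition word_of :: "'a list \<Rightarrow> 'a"
  where "word_of w = word (map (inv_into UNIV letter) w)"

lemma letters_of_word:
  assumes "w \<in> words H B m"
  shows "map (inv_into UNIV letter) w \<in> lists (letter -` B)" "weight (map (inv_into UNIV letter) w) = m"
    "map letter (map (inv_into UNIV letter) w) = w"
proof -
  have *: "letter (inv_into UNIV letter b) = b" if "b \<in> set w" for b
    using that assms basis_of_letters(3)[OF B] by (intro f_inv_into_f) (auto simp: words_def)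
  then show "map (inv_into UNIV letter) w \<in> lists (letter -` B)"
    using assms by (fastforce simp: words_def)
  show l: "map letter (map (inv_into UNIV letter) w) = w"
    using * by (simp add: map_idI)
  have "weight (map (inv_into UNIV letter) w) = sum_list (map (letter_weight H) (map letter (map (inv_into UNIV letter) w)))"
    by (simp add: weight_def comp_def)
  also have "\<dots> = m"
    unfolding l using assms by (simp add: words_def)
  finally show "weight (map (inv_into UNIV letter) w) = m" .
qed

lemma words_of_letters:
  assumes "z \<in> lists (letter -` B)"
  shows "map letter z \<in> words H B (weight z)" "map (inv_into UNIV letter) (map letter z) = z"
  using assms inj_letter by (auto simp: words_def weight_def comp_def intro!: map_idI)

lemma inj_word_of: "inj_on word_of (words H B m)"
proof (rule inj_onI)
  fix w w' assume w: "w \<in> words H B m" "w' \<in> words H B m" "word_of w = word_of w'"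
  then have "map (inv_into UNIV letter) w = map (inv_into UNIV letter) w'"
    using inj_onD[OF inj_word] letters_of_word(1) by (simp add: word_of_def)
  then show "w = w'"
    using letters_of_word(3)[OF w(1)] letters_of_word(3)[OF w(2)] by simp
qed

lemma independent_word_of: "independent (word_of ` words H B m)"
  by (rule independent_mono[OF independent_words]) (use letters_of_word(1) in \<open>auto simp: word_of_def\<close>)

lemma span_word_of: "span (word_of ` words H B m) = H m"
proof (rule antisym)
  show "span (word_of ` words H B m) \<subseteq> H m"
    by (rule span_minimal[OF _ subspace_H])
      (use word_weight letters_of_word in \<open>fastforce simp: word_of_def\<close>)
  show "H m \<subseteq> span (word_of ` words H B m)"
  proof
    fix y assume y: "y \<in> H m"
    have "y \<in> span (word ` map (inv_into UNIV letter) ` words H B m)"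
      by (rule homogeneous_in_span[OF y]) (use words_of_letters in \<open>force\<close>)
    then show "y \<in> span (word_of ` words H B m)"
      by (simp add: image_image word_of_def)
  qed
qed

lemma finite_words:
  assumes locally_finite shows "finite (words H B m)"
proof -
  obtain T where T: "finite T" "span T = H m"
    using assms by (auto simp: locally_finite_def)
  have "word_of ` words H B m \<subseteq> span T"
    using span_superset[of "word_of ` words H B m"] by (simp only: T(2) span_word_of)
  then have "finite (word_of ` words H B m)"
    using independent_span_bound[OF T(1) independent_word_of] by blast
  then show ?thesis
    using inj_word_of by (simp add: finite_image_iff)
qed

text \<open>Since the antipode preserves the weight, the shorter words left over in \<open>coord_antipode_word\<close> all have
the weight of \<open>w\<close>.\<close>

lemma S_word_of:
  assumes w: "w \<in> words H B m"
  shows "S (word_of w) - scale ((-1) ^ length w) (word_of (rev w))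
    \<in> span (word_of ` {u \<in> words H B m. length u < length w})"
proof -
  let ?z = "map (inv_into UNIV letter) w"
  let ?y = "S (word ?z) - scale ((-1) ^ length ?z) (word (rev ?z))"
  have z: "?z \<in> lists (letter -` B)" "weight ?z = m"
    using letters_of_word[OF w] by auto
  have "weight (rev ?z) = m" 
    using z(2) by (simp add: weight_def rev_map[symmetric])
  moreover have "rev ?z \<in> lists (letter -` B)"
    using z(1) by (simp only: in_lists_conv_set set_rev)
  ultimately have "word (rev ?z) \<in> H m"
    using word_weight by blast
  then have "?y \<in> H m"
    using S_word_weight[OF z(1)] z(2) by (intro subspace_diff subspace_scale subspace_H) auto
  then have "?y \<in> span (word ` map (inv_into UNIV letter) ` {u \<in> words H B m. length u < length w})"
  proof (rule homogeneous_in_span)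
    fix z assume z: "z \<in> lists (letter -` B)" "weight z = m" "coord z ?y \<noteq> 0"
    have "length z < length w"
      using coord_antipode_word[of ?z z] z(3) by (cases "length z < length w") (auto simp: coord_simps)
    with z show "z \<in> map (inv_into UNIV letter) ` {u \<in> words H B m. length u < length w}"
      using words_of_letters[OF z(1)] by (intro image_eqI[of _ _ "map letter z"]) auto
  qed
  then show ?thesis
    by (simp add: word_of_def image_image rev_map)
qed

end

section \<open>Characteristic polynomials of triangular maps\<close>

text \<open>Separate bases of source and target put the change of basis (\<open>f\<close> the identity) and the endomorphism
itself under one composition law.\<close>

definition transition_mat ::
  "('k::field \<Rightarrow> 'v::ab_group_add \<Rightarrow> 'v) \<Rightarrow> 'v list \<Rightarrow> 'v list \<Rightarrow> ('v \<Rightarrow> 'v) \<Rightarrow> 'k mat"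
  where "transition_mat scale bs cs f = mat (length cs) (length bs)
    (\<lambda>(i, j). module.representation scale (set cs) (f (bs ! j)) (cs ! i))"

context vector_space
begin

lemma transition_mat_comp:
  assumes cs: "distinct cs" "independent (set cs)" and ds: "independent (set ds)"
    and f: "f ` set bs \<subseteq> span (set cs)"
    and g: "Vector_Spaces.linear scale scale g" "g ` set cs \<subseteq> span (set ds)"
  shows "transition_mat scale cs ds g * transition_mat scale bs cs f = transition_mat scale bs ds (\<lambda>x. g (f x))"
proof (rule eq_matI)
  fix i j
  assume "i < dim_row (transition_mat scale bs ds (\<lambda>x. g (f x)))"
    and "j < dim_col (transition_mat scale bs ds (\<lambda>x. g (f x)))"
  then have i: "i < length ds" and j: "j < length bs"
    by (auto simp: transition_mat_def)
  let ?r = "\<lambda>k. representation (set cs) (f (bs ! j)) (cs ! k)"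
  have fb: "f (bs ! j) \<in> span (set cs)"
    using f j by auto
  have gs: "g (cs ! k) \<in> span (set ds)" if "k < length cs" for k
    using g(2) that by auto
  have "f (bs ! j) = (\<Sum>c\<in>set cs. scale (representation (set cs) (f (bs ! j)) c) c)"
    using sum_representation_eq[OF cs(2) fb, of "set cs"] by simp
  also have "\<dots> = (\<Sum>k<length cs. scale (?r k) (cs ! k))"
    using bij_betw_nth[OF cs(1) refl refl] by (rule sum.reindex_bij_betw[symmetric])
  finally have "g (f (bs ! j)) = (\<Sum>k<length cs. scale (?r k) (g (cs ! k)))"
    by (metis (no_types, lifting) linear_sumD[OF g(1)] linear_scaleD[OF g(1)] sum.cong)
  moreover have "representation (set ds) (\<Sum>k<length cs. scale (?r k) (g (cs ! k))) =
      (\<lambda>b. \<Sum>k<length cs. representation (set ds) (scale (?r k) (g (cs ! k))) b)"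
    by (rule representation_sum[OF ds]) (auto intro: span_scale gs)
  ultimately have "representation (set ds) (g (f (bs ! j))) (ds ! i) =
      (\<Sum>k<length cs. ?r k * representation (set ds) (g (cs ! k)) (ds ! i))"
    by (simp add: representation_scale[OF ds gs])
  with i j show "(transition_mat scale cs ds g * transition_mat scale bs cs f) $$ (i, j) =
      transition_mat scale bs ds (\<lambda>x. g (f x)) $$ (i, j)"
    by (simp add: transition_mat_def scalar_prod_def atLeast0LessThan mult.commute)
qed (auto simp: transition_mat_def)

lemma transition_mat_id:
  assumes "distinct bs" "independent (set bs)"
  shows "transition_mat scale bs bs (\<lambda>x. x) = 1\<^sub>m (length bs)"
  by (rule eq_matI)
    (use assms in \<open>auto simp: transition_mat_def representation_basis nth_eq_iff_index_eq\<close>)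

lemma ordered_basis_length:
  assumes "ordered_basis scale U bs" shows "length bs = dim U"
  using assms dim_span_eq_card_independent[of "set bs"]
  by (auto simp: ordered_basis_def distinct_card)

lemma char_poly_on_eq:
  assumes bs: "ordered_basis scale U bs" and f: "Vector_Spaces.linear scale scale f" "f ` U \<subseteq> U"
  shows "char_poly_on scale U f = char_poly (endo_matrix scale bs f)"
proof -
  define cs where "cs = (SOME bs. ordered_basis scale U bs)"
  have cs: "ordered_basis scale U cs"
    unfolding cs_def using bs by (rule someI)
  have len: "length cs = length bs"
    using ordered_basis_length[OF bs] ordered_basis_length[OF cs] by simp
  note b = bs[unfolded ordered_basis_def] and c = cs[unfolded ordered_basis_def]
  have in_U: "set bs \<subseteq> U" "set cs \<subseteq> U"
    using b c span_superset by blast+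
  have em: "endo_matrix scale xs f = transition_mat scale xs xs f" for xs
    by (simp add: endo_matrix_def transition_mat_def)
  let ?P = "transition_mat scale bs cs (\<lambda>x. x)" and ?Q = "transition_mat scale cs bs (\<lambda>x. x)"
  have id: "Vector_Spaces.linear scale scale (\<lambda>x. x)"
    by (rule linear_ident)
  have "similar_mat (endo_matrix scale cs f) (endo_matrix scale bs f)"
  proof (rule similar_matI)
    show "{endo_matrix scale cs f, endo_matrix scale bs f, ?P, ?Q} \<subseteq> carrier_mat (length bs) (length bs)"
      by (auto simp: endo_matrix_def transition_mat_def len)
    have "?P * ?Q = transition_mat scale cs cs (\<lambda>x. x)"
      by (rule transition_mat_comp) (use b c in_U id in auto)
    then show "?P * ?Q = 1\<^sub>m (length bs)"
      using transition_mat_id[of cs] c len by simp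
    have "?Q * ?P = transition_mat scale bs bs (\<lambda>x. x)"
      by (rule transition_mat_comp) (use b c in_U id in auto)
    then show "?Q * ?P = 1\<^sub>m (length bs)"
      using transition_mat_id[of bs] b by simp
    have 1: "?P * transition_mat scale bs bs f = transition_mat scale bs cs f"
      by (rule transition_mat_comp) (use b c in_U id f in auto)
    have 2: "transition_mat scale bs cs f * ?Q = transition_mat scale cs cs f"
      by (rule transition_mat_comp) (use b c in_U f in auto)
    show "endo_matrix scale cs f = ?P * endo_matrix scale bs f * ?Q"
      by (simp add: em 1 2)
  qed
  then show ?thesis
    unfolding char_poly_on_def cs_def[symmetric] by (rule char_poly_similar)
qed

lemma char_poly_on_triangular:
  assumes bs: "ordered_basis scale U bs" and f: "Vector_Spaces.linear scale scale f"
    and tri: "\<And>j. j < length bs \<Longrightarrow> f (bs ! j) - scale (c j) (bs ! j) \<in> span (set (take j bs))"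
  shows "char_poly_on scale U f = (\<Prod>j<length bs. [:- c j, 1:])"
proof -
  interpret f: Vector_Spaces.linear scale scale f by fact
  note b = bs[unfolded ordered_basis_def]
  have fb: "f (bs ! j) = (f (bs ! j) - scale (c j) (bs ! j)) + scale (c j) (bs ! j)" for j
    by simp
  have take: "span (set (take j bs)) \<subseteq> span (set bs)" for j
    by (rule span_mono) (rule set_take_subset)
  have "f (bs ! j) \<in> span (set bs)" if "j < length bs" for j
    using span_add[OF subsetD[OF take tri[OF that]] span_scale[OF span_base[OF nth_mem[OF that]], of "c j"]]
    by simp
  then have "f ` set bs \<subseteq> span (set bs)"
    by (auto simp: in_set_conv_nth)
  then have fU: "f ` U \<subseteq> U"
    using b f.span_image[of "set bs"] span_minimal[of "f ` set bs" "span (set bs)"] by auto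
  have entry: "endo_matrix scale bs f $$ (i, j) = (if i = j then c j else 0)"
    if "i < length bs" "j \<le> i" for i j
  proof -
    have j: "j < length bs" using that by simp
    have "f (bs ! j) - scale (c j) (bs ! j) \<in> span (set bs)" "scale (c j) (bs ! j) \<in> span (set bs)"
      using take tri[OF j] span_scale[OF span_base[OF nth_mem[OF j]]] by auto
    from representation_add[OF _ this] b
    have "representation (set bs) (f (bs ! j)) (bs ! i) =
        representation (set bs) (f (bs ! j) - scale (c j) (bs ! j)) (bs ! i) +
        representation (set bs) (scale (c j) (bs ! j)) (bs ! i)"
      by (simp add: fb[symmetric])
    also have "representation (set bs) (f (bs ! j) - scale (c j) (bs ! j)) (bs ! i) = 0"
    proof -
      have "representation (set bs) (f (bs ! j) - scale (c j) (bs ! j)) =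
          representation (set (take j bs)) (f (bs ! j) - scale (c j) (bs ! j))"
        by (rule representation_extend) (use b tri[OF j] in \<open>auto dest: in_set_takeD\<close>)
      moreover have "bs ! i \<notin> set (take j bs)"
        using b that by (auto simp: in_set_conv_nth nth_eq_iff_index_eq)
      ultimately show ?thesis
        using representation_ne_zero by fastforce
    qed
    also have "representation (set bs) (scale (c j) (bs ! j)) (bs ! i) = (if i = j then c j else 0)"
    proof -
      have "representation (set bs) (scale (c j) (bs ! j)) =
          (\<lambda>x. c j * representation (set bs) (bs ! j) x)"
        by (rule representation_scale) (use b j in \<open>auto intro: span_base\<close>)
      then show ?thesis
        using b j that by (auto simp: representation_basis nth_eq_iff_index_eq)
    qed
    finally show ?thesis using that j by (simp add: endo_matrix_def)
  qed
  have "char_poly_on scale U f = char_poly (endo_matrix scale bs f)"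
    by (rule char_poly_on_eq[OF bs f fU])
  also have "\<dots> = (\<Prod>a\<leftarrow>diag_mat (endo_matrix scale bs f). [:- a, 1:])"
  proof (rule char_poly_upper_triangular)
    show "endo_matrix scale bs f \<in> carrier_mat (length bs) (length bs)"
      by (simp add: endo_matrix_def)
    show "upper_triangular (endo_matrix scale bs f)"
      unfolding upper_triangular_def using entry by (auto simp: endo_matrix_def[of scale bs f])
  qed
  also have "diag_mat (endo_matrix scale bs f) = map c [0..<length bs]"
    unfolding diag_mat_def using entry by (auto simp: endo_matrix_def[of scale bs f])
  also have "(\<Prod>a\<leftarrow>map c [0..<length bs]. [:- a, 1:]) = (\<Prod>j<length bs. [:- c j, 1:])"
    by (simp add: comp_def prod.list_conv_set_nth atLeast0LessThan)
  finally show ?thesis .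
qed

end

text \<open>The two words \<open>w\<close> and \<open>rev w\<close> of a non-palindromic pair span, modulo shorter words, an invariant plane
on which \<open>f\<close> swaps the basis vectors up to a common sign, so the sum and the difference of these
vectors are eigenvectors with opposite eigenvalues. Replacing each pair by its sum and its difference
(this needs \<open>2 \<noteq> 0\<close>) and ordering the new basis by length makes the matrix of \<open>f\<close> triangular.\<close>

theorem (in vector_space) char_poly_on_signed_reversal:
  fixes word_of :: "'l list \<Rightarrow> 'b"
  assumes W: "finite W" "\<And>w. w \<in> W \<Longrightarrow> rev w \<in> W"
    and inj: "inj_on word_of W" and ind: "independent (word_of ` W)" and span: "span (word_of ` W) = U"
    and f: "Vector_Spaces.linear scale scale f"
    and tri: "\<And>w. w \<in> W \<Longrightarrow> f (word_of w) - scale ((-1) ^ length w) (word_of (rev w))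
      \<in> span (word_of ` {u \<in> W. length u < length w})"
    and two: "(2 :: 'a) \<noteq> 0"
  shows "char_poly_on scale U f =
    [:1, 1:] ^ card {w \<in> W. rev w = w \<and> odd (length w)} *
    [:-1, 1:] ^ card {w \<in> W. rev w = w \<and> even (length w)} *
    [:-1, 0, 1:] ^ (card {w \<in> W. rev w \<noteq> w} div 2)"
proof -
  interpret f: Vector_Spaces.linear scale scale f by fact
  \<comment> \<open>\<open>T\<close> selects one word of each non-palindromic pair; it carries the sum, the other word the difference.\<close>
  define T where "T = {w :: 'l list. w = (SOME v. v \<in> {w, rev w})}"
  have T_rev: "rev w \<in> T \<longleftrightarrow> w \<notin> T" if "rev w \<noteq> w" for w
  proof -
    define r where "r = (SOME v. v \<in> {w, rev w})"
    have "r \<in> {w, rev w}"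
      unfolding r_def by (rule someI[of _ w]) simp
    moreover have "{rev w, rev (rev w)} = {w, rev w}" by auto
    then have "rev w \<in> T \<longleftrightarrow> rev w = r" "w \<in> T \<longleftrightarrow> w = r"
      unfolding T_def mem_Collect_eq r_def by (simp_all only:)
    ultimately show ?thesis
      using that by auto
  qed
  define \<sigma> :: "'l list \<Rightarrow> 'a" where "\<sigma> = (\<lambda>w. if rev w = w \<or> w \<in> T then 1 else -1)"
  have \<sigma>2: "\<sigma> w * \<sigma> w = 1" for w by (simp add: \<sigma>_def)
  have \<sigma>_rev: "\<sigma> (rev w) = - \<sigma> w" if "rev w \<noteq> w" for w
    using T_rev[OF that] that by (auto simp: \<sigma>_def)
  \<comment> \<open>A palindrome gives twice its basis vector, which avoids a case distinction.\<close>
  define e where "e = (\<lambda>w. word_of w + scale (\<sigma> w) (word_of (rev w)))"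
  define low where "low = (\<lambda>n. {u \<in> W. length u < n})"
  have low_rev: "rev u \<in> low n" if "u \<in> low n" for u n
    using that W(2) by (auto simp: low_def)
  have word_of_e: "word_of w = scale (inverse 2) (if rev w = w then e w else e w - scale (\<sigma> w) (e (rev w)))" for w
  proof -
    have "(if rev w = w then e w else e w - scale (\<sigma> w) (e (rev w))) = word_of w + word_of w"
    proof (cases "rev w = w")
      case True
      then show ?thesis by (simp add: e_def \<sigma>_def)
    next
      case False
      then show ?thesis
        by (simp add: e_def \<sigma>_rev \<sigma>2 scale_right_distrib scale_right_diff_distrib)
    qed
    also have "\<dots> = scale 2 (word_of w)"
      using scale_left_distrib[of 1 1 "word_of w"] by simp
    finally show ?thesis using two by simp
  qed
  have word_of_in: "word_of u \<in> span (e ` A)" if "u \<in> A" "rev u \<in> A" for u A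
    using that
    by (subst word_of_e) (auto intro!: span_scale span_diff intro: span_base)
  have span_low: "span (word_of ` low n) \<subseteq> span (e ` low n)" for n
    by (rule span_minimal) (use low_rev word_of_in in auto)
  have span_e: "span (e ` W) = U"
  proof (rule antisym)
    show "span (e ` W) \<subseteq> U"
      unfolding span[symmetric]
      by (rule span_minimal) (use W(2) in \<open>auto simp: e_def intro!: span_add span_scale intro: span_base\<close>)
    show "U \<subseteq> span (e ` W)"
      unfolding span[symmetric]
      by (rule span_minimal) (use W(2) word_of_in in auto)
  qed
  have f_e: "f (e w) - scale ((-1) ^ length w * \<sigma> w) (e w) \<in> span (e ` low (length w))" if w: "w \<in> W" for w
  proof -
    let ?s = "(-1) ^ length w :: 'a"
    have "f (e w) - scale (?s * \<sigma> w) (e w) =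
      (f (word_of w) - scale ?s (word_of (rev w))) +
      scale (\<sigma> w) (f (word_of (rev w)) - scale ?s (word_of w))"
      by (simp add: e_def f.add f.scale scale_right_distrib scale_right_diff_distrib algebra_simps
          mult.assoc \<sigma>2)
    also have "\<dots> \<in> span (word_of ` low (length w))"
      using tri[OF w] tri[OF W(2)[OF w]] by (auto simp: low_def intro!: span_add span_scale)
    finally show ?thesis using span_low by blast
  qed
  obtain ws0 where ws0: "set ws0 = W" "distinct ws0"
    using finite_distinct_list[OF W(1)] by blast
  define ws where "ws = sort_key length ws0"
  have ws: "set ws = W" "distinct ws" "sorted (map length ws)"
    using ws0 by (simp_all add: ws_def)
  define bs where "bs = map e ws"
  have basis: "ordered_basis scale U bs"
  proof -
    have set_bs: "set bs = e ` W" by (simp add: bs_def ws)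
    obtain A where A: "A \<subseteq> set bs" "independent A" "set bs \<subseteq> span A"
      using maximal_independent_subset by blast
    have spanA: "span A = U"
      using span_e set_bs span_mono[OF A(1)] span_minimal[OF A(3) subspace_span] by auto
    have "card A = dim U"
      using dim_span_eq_card_independent[OF A(2)] spanA by simp
    also have "\<dots> = card W"
      using dim_span_eq_card_independent[OF ind] span inj by (simp add: card_image)
    also have "\<dots> = length bs"
      using ws by (simp add: bs_def flip: distinct_card)
    finally have card: "card A = length bs" .
    have "A = set bs"
      using A(1) card card_length[of bs] by (intro card_seteq) auto
    then show ?thesis
      unfolding ordered_basis_def using A(2) spanA card card_distinct[of bs] by auto
  qed
  define c where "c = (\<lambda>w. (-1) ^ length w * \<sigma> w)"
  have "char_poly_on scale U f = (\<Prod>j<length bs. [:- c (ws ! j), 1:])"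
  proof (rule char_poly_on_triangular[OF basis f])
    fix j assume "j < length bs"
    then have j: "j < length ws" by (simp add: bs_def)
    \<comment> \<open>All words shorter than \<open>ws ! j\<close> occur before it, so lower order means earlier in the basis.\<close>
    have "e ` low (length (ws ! j)) \<subseteq> set (take j bs)"
    proof (rule image_subsetI)
      fix u assume "u \<in> low (length (ws ! j))"
      then obtain i where i: "i < length ws" "u = ws ! i" "length (ws ! i) < length (ws ! j)"
        using ws(1) by (auto simp: low_def in_set_conv_nth)
      then have "i < j"
        using sorted_nth_mono[OF ws(3), of j i] by (cases "i < j") auto
      then show "e u \<in> set (take j bs)"
        using nth_mem[of i "take j ws"] i j by (auto simp: bs_def take_map)
    qed
    then have "span (e ` low (length (ws ! j))) \<subseteq> span (set (take j bs))"
      by (rule span_mono)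
    moreover have "f (e (ws ! j)) - scale (c (ws ! j)) (e (ws ! j)) \<in> span (e ` low (length (ws ! j)))"
      using f_e[of "ws ! j"] j ws(1) by (auto simp: c_def)
    ultimately show "f (bs ! j) - scale (c (ws ! j)) (bs ! j) \<in> span (set (take j bs))"
      using j by (auto simp: bs_def)
  qed
  also have "\<dots> = (\<Prod>w\<in>W. [:- c w, 1:])"
    using prod.reindex_bij_betw[OF bij_betw_nth[OF ws(2) refl ws(1)[symmetric]], of "\<lambda>w. [:- c w, 1:]"]
    by (simp add: bs_def)
  also have "\<dots> = (\<Prod>w | w \<in> W \<and> rev w = w \<and> odd (length w). [:- c w, 1:]) *
      (\<Prod>w | w \<in> W \<and> rev w = w \<and> even (length w). [:- c w, 1:]) *
      (\<Prod>w | w \<in> W \<and> rev w \<noteq> w. [:- c w, 1:])"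
    using W(1)
    by (subst prod.union_disjoint[symmetric], simp, simp, blast,
        subst prod.union_disjoint[symmetric], simp, simp, blast)
      (rule prod.cong, auto)
  also have "(\<Prod>w | w \<in> W \<and> rev w = w \<and> odd (length w). [:- c w, 1:]) =
      [:1, 1:] ^ card {w \<in> W. rev w = w \<and> odd (length w)}"
    by (simp add: c_def \<sigma>_def)
  also have "(\<Prod>w | w \<in> W \<and> rev w = w \<and> even (length w). [:- c w, 1:]) =
      [:-1, 1:] ^ card {w \<in> W. rev w = w \<and> even (length w)}"
    by (simp add: c_def \<sigma>_def)
  also have "(\<Prod>w | w \<in> W \<and> rev w \<noteq> w. [:- c w, 1:]) =
      [:-1, 0, 1:] ^ (card {w \<in> W. rev w \<noteq> w} div 2)"
  proof -
    define M where "M = {w \<in> W. rev w \<noteq> w \<and> w \<in> T}"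
    have fin: "finite M" using W(1) by (simp add: M_def)
    have split: "{w \<in> W. rev w \<noteq> w} = M \<union> rev ` M"
    proof
      show "{w \<in> W. rev w \<noteq> w} \<subseteq> M \<union> rev ` M"
      proof
        fix w assume "w \<in> {w \<in> W. rev w \<noteq> w}"
        then have "w \<in> M \<or> rev w \<in> M"
          using T_rev[of w] W(2) by (auto simp: M_def)
        then show "w \<in> M \<union> rev ` M" by (metis UnI1 UnI2 imageI rev_rev_ident)
      qed
    qed (use W(2) in \<open>auto simp: M_def\<close>)
    have disj: "M \<inter> rev ` M = {}"
      using T_rev by (auto simp: M_def)
    have "card {w \<in> W. rev w \<noteq> w} = 2 * card M"
      unfolding split using fin disj by (simp add: card_Un_disjoint card_image)
    moreover have "(\<Prod>w | w \<in> W \<and> rev w \<noteq> w. [:- c w, 1:]) = (\<Prod>w\<in>M. [:- c w, 1:] * [:- c (rev w), 1:])"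
      unfolding prod.distrib split using fin disj
      by (simp add: prod.union_disjoint prod.reindex comp_def)
    moreover have "[:- c w, 1:] * [:- c (rev w), 1:] = [:-1, 0, 1:]" if "w \<in> M" for w
    proof -
      have "c (rev w) = - c w"
        using that by (simp add: c_def M_def \<sigma>_rev)
      moreover have "c w * c w = 1"
        by (cases "even (length w)") (simp_all add: c_def \<sigma>_def)
      ultimately show ?thesis by simp
    qed
    ultimately show ?thesis by simp
  qed
  finally show ?thesis .
qed

section \<open>The characteristic polynomial of the antipode\<close>

theorem theorem21:
  fixes scale :: "'k::field_char_0 \<Rightarrow> 'a::ring_1 \<Rightarrow> 'a"
    and comult :: "'a \<Rightarrow> ('a \<times> 'a \<Rightarrow>\<^sub>0 'k)"
    and counit :: "'a \<Rightarrow> 'k"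
    and H :: "nat \<Rightarrow> 'a set"
    and S :: "'a \<Rightarrow> 'a"
    and scaleV :: "'k \<Rightarrow> 'v::ab_group_add \<Rightarrow> 'v"
    and V :: "nat \<Rightarrow> 'v set"
    and B :: "'a set"
    and m :: nat
  assumes "graded_connected_hopf_algebra scale comult counit H"
    and "graded_connected_hopf_algebra.locally_finite scale H"
    and "graded_connected_hopf_algebra.cofree_over scale comult counit H scaleV V"
    and "bialgebra.is_antipode scale comult counit S"
    and "graded_connected_hopf_algebra.homogeneous_basis_of_primitives scale comult H B"
  shows "char_poly_on scale (H m) S =
    [:1, 1:] ^ opal H B m * [:-1, 1:] ^ epal H B m * [:-1, 0, 1:] ^ (npal H B m div 2)"
proof -
  interpret H: graded_connected_hopf_algebra scale comult counit H by fact
  obtain \<phi> where V: "vector_space scaleV" "grading scaleV V"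
      and \<phi>: "H.deconcatenation_iso scaleV V \<phi>"
    using assms(3) by (auto simp: H.cofree_over_def)
  interpret cofree_hopf_algebra_primitive_basis scale comult counit H scaleV V \<phi> S B
    using V \<phi> assms(4,5)
    by (intro cofree_hopf_algebra_primitive_basis.intro cofree_hopf_algebra.intro
        cofree_hopf_algebra_axioms.intro cofree_hopf_algebra_primitive_basis_axioms.intro assms(1))
  have rev: "w \<in> words H B m \<Longrightarrow> rev w \<in> words H B m" for w
    by (simp add: words_def rev_map[symmetric])
  show ?thesis
    unfolding opal_def epal_def npal_def
    by (rule H.char_poly_on_signed_reversal[OF finite_words[OF assms(2)] rev inj_word_of
          independent_word_of span_word_of linear_S S_word_of]) auto
qed

end
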